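(* Let $d\ge1$ and let $\epsilon\in(0,2]$ be fixed. For $R\ge1$ let $$K=K(R,\epsilon/2):=\frac{\log|E_R|}{\delta(R,\epsilon/2)}.$$ Then $$\inf_{x\in\mathbb{Z}^d}\ \liminf_{R\to\infty}\ \mathbb{P}\big[T_{K}(0,x)<T_{K}(0,\partial B_R)\big]=0\iff \theta_d(p_{c,d})=0 .$$
   Context: Lattice: $\mathbb{Z}^d$ with nearest-neighbor edge set $E$, origin $0$, and graph distance $d(\cdot,\cdot)$. For $R\in\mathbb{N}$, $B_R=\{v\in\mathbb{Z}^d:d(0,v)\le R\}$, $E_R$ is the set of edges between vertices of $B_R$, and $\partial B_R$ is the set of vertices at distance exactly $R$ from $0$. Probability space: i.i.d. weights $w(e)$, $e\in E$, uniform on $[0,1]$, with product measure $\mathbb{P}$. Bernoulli bond percolation with parameter $p\in[0,1]$: the random subgraph of $\mathbb{Z}^d$ with all vertices and exactly the edges $e$ with $w(e)<p$. $\theta_d(p)$ is the probability that $0$ lies in an infinite connected component (cluster) of this subgraph, and $p_{c,d}=\inf\{p:\theta_d(p)>0\}$. First passage percolation: for $K>0$ set $\tau_{K,e}=e^{K w(e)}$ (here the base $e$ is Euler's number), $T_K(\gamma)=\sum_{e\in\gamma}\tau_{K,e}$ for a path $\gamma$, $T_K(x,y)=\inf_\gamma T_K(\gamma)$ over paths $\gamma$ from $x$ to $y$ in $\mathbb{Z}^d$, and $T_K(0,\partial B_R)=\min_{v\in\partial B_R}T_K(0,v)$. For $R\ge1$ and $\epsilon\in(0,1]$, $$\delta(R,\epsilon)=\frac{1-(1-\epsilon)^{1/|E_R|}}{|E_R|-1}.$$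 *)

theory Defs
  imports "HOL-Probability.Probability"
begin

text \<open>
  The lattice of dimension \<open>d \<ge> 1\<close> is the type \<^typ>\<open>int ^ 'd\<close> with \<open>d = CARD('d)\<close>.
  Quantities that depend on the dimension only take an argument of type \<^typ>\<open>'d itself\<close>.
\<close>

definition lattice_adj :: "int ^ 'd \<Rightarrow> int ^ 'd \<Rightarrow> bool" where
  "lattice_adj x y \<longleftrightarrow> (\<Sum>i\<in>UNIV. \<bar>x $ i - y $ i\<bar>) = 1"

definition lattice_edges :: "(int ^ 'd) set set" where
  "lattice_edges = {{x, y} | x y. lattice_adj x y}"

text \<open>
  As usual in first passage percolation, a path is a nonempty sequence of consecutively adjacent
  vertices; vertices may be revisited, and every traversal of an edge then counts in the passage
  time. As the edge times are positive, self-avoiding paths would give the same infima.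
\<close>

definition lattice_paths :: "int ^ 'd \<Rightarrow> int ^ 'd \<Rightarrow> (int ^ 'd) list set" where
  "lattice_paths x y =
     {\<gamma>. \<gamma> \<noteq> [] \<and> hd \<gamma> = x \<and> last \<gamma> = y \<and> successively lattice_adj \<gamma>}"

fun path_edges :: "'a list \<Rightarrow> 'a set list" where
  "path_edges (u # v # \<gamma>) = {u, v} # path_edges (v # \<gamma>)"
| "path_edges _ = []"

definition graph_dist :: "int ^ 'd \<Rightarrow> int ^ 'd \<Rightarrow> nat" where
  "graph_dist x y = (LEAST n. \<exists>\<gamma>\<in>lattice_paths x y. length (path_edges \<gamma>) = n)"

definition lattice_ball :: "nat \<Rightarrow> (int ^ 'd) set" where
  "lattice_ball R = {v. graph_dist 0 v \<le> R}"

definition ball_boundary :: "nat \<Rightarrow> (int ^ 'd) set" where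
  "ball_boundary R = {v. graph_dist 0 v = R}"

definition ball_edges :: "nat \<Rightarrow> (int ^ 'd) set set" where
  "ball_edges R = {e \<in> lattice_edges. e \<subseteq> lattice_ball R}"

definition weight_space :: "((int ^ 'd) set \<Rightarrow> real) measure" where
  "weight_space = (\<Pi>\<^sub>M e\<in>lattice_edges. uniform_measure lborel {0..1})"

definition cluster :: "((int ^ 'd) set \<Rightarrow> real) \<Rightarrow> real \<Rightarrow> int ^ 'd \<Rightarrow> (int ^ 'd) set" where
  "cluster w p x = {y. \<exists>\<gamma>\<in>lattice_paths x y. \<forall>e\<in>set (path_edges \<gamma>). w e < p}"

definition percolation_prob :: "'d::finite itself \<Rightarrow> real \<Rightarrow> real" where
  "percolation_prob d p =
     measure weight_space {w \<in> space weight_space. infinite (cluster w p (0 :: int ^ 'd))}"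

definition critical_prob :: "'d::finite itself \<Rightarrow> real" where
  "critical_prob d = Inf {p \<in> {0..1}. percolation_prob d p > 0}"

definition path_time :: "real \<Rightarrow> ((int ^ 'd) set \<Rightarrow> real) \<Rightarrow> (int ^ 'd) list \<Rightarrow> real" where
  "path_time K w \<gamma> = (\<Sum>e\<leftarrow>path_edges \<gamma>. exp (K * w e))"

definition passage_time ::
    "real \<Rightarrow> ((int ^ 'd) set \<Rightarrow> real) \<Rightarrow> int ^ 'd \<Rightarrow> int ^ 'd \<Rightarrow> real" where
  "passage_time K w x y = (INF \<gamma>\<in>lattice_paths x y. path_time K w \<gamma>)"

definition boundary_time :: "real \<Rightarrow> ((int ^ 'd) set \<Rightarrow> real) \<Rightarrow> nat \<Rightarrow> real" where
  "boundary_time K w R = Min (passage_time K w 0 ` ball_boundary R)"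

definition delta :: "'d::finite itself \<Rightarrow> nat \<Rightarrow> real \<Rightarrow> real" where
  "delta d R \<epsilon> =
     (let n = real (card (ball_edges R :: (int ^ 'd) set set))
      in (1 - (1 - \<epsilon>) powr (1 / n)) / (n - 1))"

definition K_param :: "'d::finite itself \<Rightarrow> nat \<Rightarrow> real \<Rightarrow> real" where
  "K_param d R \<epsilon> = ln (real (card (ball_edges R :: (int ^ 'd) set set))) / delta d R \<epsilon>"

end

theory Submission
  imports Defs "HOL-Real_Asymp.Real_Asymp"
begin

text \<open>
  As \<open>K\<close> grows, comparing passage times amounts to comparing the largest weights on the paths.

  If there is percolation at \<open>p\<^sub>c\<close>, then on the event that \<open>0\<close> and \<open>x\<close> are joined by edges of weight below
  \<open>p\<^sub>c\<close> the point \<open>x\<close> is reached before \<open>\<partial>B\<^sub>R\<close> for all large \<open>R\<close>, because the cluster of \<open>0\<close> is finite at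
  every level below \<open>p\<^sub>c\<close>. The probability of this event is bounded below uniformly in \<open>x\<close>: by the
  Burton-Keane argument there are at most two infinite clusters, so with positive probability all of
  them meet a fixed ball around \<open>0\<close>, and opening the edges of this ball and of a ball around \<open>x\<close>
  connects \<open>0\<close> to \<open>x\<close>.

  If there is no percolation at \<open>p\<^sub>c\<close>, pick \<open>p\<^sub>c < p < p'\<close> with \<open>\<theta>(p')\<close> small. Off an event of small
  probability \<open>x\<close> is not in an infinite cluster of level \<open>p'\<close>, and reaching \<open>x\<close> before \<open>\<partial>B\<^sub>R\<close> forces a
  ball around \<open>x\<close> to be reached before all infinite clusters of level \<open>p\<close>. Opening the edges of this ball
  makes it the place where these clusters are entered first. For distant points \<open>x\<close> these
  events are disjoint, so their probabilities cannot all be bounded away from \<open>0\<close>.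
\<close>

section \<open>Lattice geometry\<close>

text \<open>Numerically everything rests on one estimate. With \<open>n = |E_R|\<close> one has
  \<open>delta \<le> 1 / (n - 1)\<close>, hence \<open>K \<ge> (n - 1) ln n\<close>, so for each
  fixed \<open>c > 0\<close> eventually \<open>n \<le> exp (K * c)\<close>: a walk through all edges
  of the ball weighs no more than one edge whose weight is larger by \<open>c\<close>. This is why
  two levels \<open>p < p'\<close> occur: an edge into the level-\<open>p'\<close> cluster of
  \<open>x\<close> costs at least \<open>exp (K * p')\<close>, which must outweigh a walk inside an
  infinite level-\<open>p\<close> cluster to the boundary of the ball. Both directions modify
  configurations on finite balls. Opening a ball has the fixed price \<open>p ^ k\<close> for its
  \<open>k\<close> edges, but only on events that do not depend on these edges. The events to be
  modified are therefore stated with the ball edges deleted or counted as open. Two infinite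
  clusters are as good as one, because a single ball catches a point of each; so no merging of
  clusters is needed, and the count of trifurcation balls alone excludes three. That
  \<open>\<theta>(p')\<close> is small for some \<open>p'\<close> above the critical value is
  right-continuity of \<open>\<theta>\<close>.\<close>

definition l1 :: "int ^ 'd \<Rightarrow> nat" where
  "l1 v = nat (\<Sum>i\<in>UNIV. \<bar>v $ i\<bar>)"

lemma int_l1: "int (l1 v) = (\<Sum>i\<in>UNIV. \<bar>v $ i\<bar>)"
  by (simp add: l1_def sum_nonneg)

lemma l1_0 [simp]: "l1 0 = 0"
  by (simp add: l1_def)

lemma l1_minus: "l1 (x - y) = l1 (y - x)"
  by (simp add: l1_def abs_minus_commute)

lemma l1_eq_0_iff [simp]: "l1 v = 0 \<longleftrightarrow> v = 0"
proof -
  have "l1 v = 0 \<longleftrightarrow> int (l1 v) = 0" by simp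
  also have "\<dots> \<longleftrightarrow> v = 0"
    unfolding int_l1 by (subst sum_nonneg_eq_0_iff) (auto simp: vec_eq_iff)
  finally show ?thesis .
qed

lemma l1_triangle: "l1 (x + y) \<le> l1 x + l1 y"
proof -
  have "int (l1 (x + y)) \<le> int (l1 x) + int (l1 y)"
    unfolding int_l1 sum.distrib[symmetric] by (intro sum_mono) simp
  then show ?thesis by simp
qed

lemma lattice_adj_l1: "lattice_adj x y \<longleftrightarrow> l1 (x - y) = 1"
proof -
  have "l1 (x - y) = 1 \<longleftrightarrow> int (l1 (x - y)) = 1" by simp
  then show ?thesis unfolding int_l1 lattice_adj_def by simp
qed

lemma lattice_adj_sym: "lattice_adj x y \<longleftrightarrow> lattice_adj y x"
  by (simp add: lattice_adj_l1 l1_minus)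

lemma lattice_adj_l1_le: "lattice_adj x y \<Longrightarrow> l1 y \<le> Suc (l1 x)"
  using l1_triangle[of x "y - x"] by (simp add: lattice_adj_l1 l1_minus[of y])

lemma lattice_adj_add [simp]: "lattice_adj (x + a) (y + a) \<longleftrightarrow> lattice_adj x y"
  by (simp add: lattice_adj_l1)

lemma edge_in_lattice_edges [simp]: "{x, y} \<in> lattice_edges \<longleftrightarrow> lattice_adj x y"
  unfolding lattice_edges_def by (auto simp: doubleton_eq_iff lattice_adj_sym)

lemma countable_lattice_edges [simp]: "countable (lattice_edges :: (int ^ 'd::finite) set set)"
proof -
  have "lattice_edges \<subseteq> (\<lambda>(x, y). {x, y}) ` (UNIV :: ((int ^ 'd) \<times> (int ^ 'd)) set)"
    by (auto simp: lattice_edges_def)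
  then show ?thesis by (rule countable_subset) simp
qed

lemma l1_axis [simp]: "l1 (axis i c :: int ^ 'd::finite) = nat \<bar>c\<bar>"
proof -
  have "(\<Sum>j\<in>UNIV. \<bar>(axis i c :: int ^ 'd) $ j\<bar>) = (\<Sum>j\<in>UNIV. if i = j then \<bar>c\<bar> else 0)"
    by (intro sum.cong) (auto simp: axis_def)
  then show ?thesis by (simp add: l1_def)
qed

lemma l1_closer:
  fixes v :: "int ^ 'd::finite"
  assumes "v \<noteq> 0"
  obtains u where "lattice_adj v u" "l1 v = Suc (l1 u)"
proof -
  obtain i where i: "v $ i \<noteq> 0"
    using assms by (auto simp: vec_eq_iff)
  define u where "u = v - axis i (sgn (v $ i))"
  have "lattice_adj v u"
    using i by (auto simp: lattice_adj_l1 u_def sgn_if)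
  moreover have "(\<Sum>j\<in>UNIV. \<bar>v $ j\<bar>) = (\<Sum>j\<in>UNIV. \<bar>u $ j\<bar> + (if j = i then 1 else 0))"
    using i by (intro sum.cong) (auto simp: u_def axis_def sgn_if)
  then have "int (l1 v) = int (l1 u) + 1"
    unfolding int_l1 by (simp add: sum.distrib)
  ultimately show ?thesis by (intro that) auto
qed

section \<open>Lattice paths and the graph distance\<close>

lemma length_path_edges: "length (path_edges \<gamma>) = length \<gamma> - 1"
  by (induction \<gamma> rule: path_edges.induct) auto

lemma path_edges_append_last:
  "\<gamma> \<noteq> [] \<Longrightarrow> path_edges (\<gamma> @ \<delta>) = path_edges \<gamma> @ path_edges (last \<gamma> # \<delta>)"
  by (induction \<gamma> rule: path_edges.induct) auto

lemma lattice_path_single [simp]: "[x] \<in> lattice_paths x y \<longleftrightarrow> x = y"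
  by (auto simp: lattice_paths_def)

lemma lattice_path_extend:
  assumes "\<gamma> \<in> lattice_paths x y" "lattice_adj y z"
  shows "\<gamma> @ [z] \<in> lattice_paths x z"
    "path_edges (\<gamma> @ [z]) = path_edges \<gamma> @ [{y, z}]"
  using assms by (auto simp: lattice_paths_def successively_append_iff path_edges_append_last)

lemma lattice_path_induct [consumes 1, case_names single extend]:
  assumes "\<gamma> \<in> lattice_paths x y"
    and "P [x] x"
    and "\<And>\<gamma> y z. \<gamma> \<in> lattice_paths x y \<Longrightarrow> lattice_adj y z \<Longrightarrow> P \<gamma> y \<Longrightarrow> P (\<gamma> @ [z]) z"
  shows "P \<gamma> y"
  using assms(1)
proof (induction \<gamma> arbitrary: y rule: rev_induct)
  case (snoc z \<gamma>)
  show ?case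
  proof (cases "\<gamma> = []")
    case True
    with snoc.prems show ?thesis using assms(2) by (auto simp: lattice_paths_def)
  next
    case False
    with snoc.prems have "\<gamma> \<in> lattice_paths x (last \<gamma>)" "lattice_adj (last \<gamma>) z" "y = z"
      by (auto simp: lattice_paths_def successively_append_iff)
    with snoc.IH[of "last \<gamma>"] assms(3) show ?thesis by blast
  qed
qed (auto simp: lattice_paths_def)

lemma lattice_path_join:
  assumes "\<gamma> \<in> lattice_paths x y" "\<delta> \<in> lattice_paths y z"
  obtains \<eta> where "\<eta> \<in> lattice_paths x z" "path_edges \<eta> = path_edges \<gamma> @ path_edges \<delta>"
proof -
  have "\<exists>\<eta>\<in>lattice_paths x z. path_edges \<eta> = path_edges \<gamma> @ path_edges \<delta>"
    using assms(2)
  proof (induction rule: lattice_path_induct)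
    case single
    then show ?case using assms(1) by auto
  next
    case (extend \<delta> y' z')
    then obtain \<eta> where "\<eta> \<in> lattice_paths x y'" "path_edges \<eta> = path_edges \<gamma> @ path_edges \<delta>"
      by blast
    with lattice_path_extend[OF this(1) extend(2)] lattice_path_extend[OF extend(1,2)] show ?case
      by (intro bexI[of _ "\<eta> @ [z']"]) auto
  qed
  then show ?thesis using that by blast
qed

lemma path_edges_lattice:
  assumes "\<gamma> \<in> lattice_paths x y"
  shows "set (path_edges \<gamma>) \<subseteq> lattice_edges"
  using assms by (induction rule: lattice_path_induct) (auto simp: lattice_path_extend)

lemma lattice_path_l1:
  fixes x y :: "int ^ 'd::finite"
  assumes "\<gamma> \<in> lattice_paths x y"
  shows "l1 (x - y) \<le> length (path_edges \<gamma>)"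
  using assms
proof (induction rule: lattice_path_induct)
  case (extend \<gamma> y z)
  have "l1 (x - z) \<le> l1 (x - y) + l1 (y - z)"
    using l1_triangle[of "x - y" "y - z"] by simp
  with extend show ?case by (simp add: lattice_path_extend lattice_adj_l1)
qed simp

lemma ex_lattice_path:
  fixes x y :: "int ^ 'd::finite"
  shows "\<exists>\<gamma>\<in>lattice_paths x y. length (path_edges \<gamma>) = l1 (y - x)"
proof (induction "l1 (y - x)" arbitrary: y)
  case 0
  then show ?case by (intro bexI[of _ "[x]"]) auto
next
  case (Suc n)
  then have "y - x \<noteq> 0" by auto
  then obtain u where u: "lattice_adj (y - x) u" "l1 (y - x) = Suc (l1 u)"
    by (rule l1_closer)
  then obtain \<gamma> where "\<gamma> \<in> lattice_paths x (u + x)" "length (path_edges \<gamma>) = l1 u"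
    using Suc(1)[of "u + x"] Suc(2) by auto
  moreover have "lattice_adj (u + x) y"
    using u(1) lattice_adj_add[of "y - x" x u] by (simp add: lattice_adj_sym)
  ultimately show ?case
    using u by (intro bexI[of _ "\<gamma> @ [y]"]) (auto simp: lattice_path_extend)
qed

lemma graph_dist_eq: "graph_dist x y = l1 (y - x)"
  unfolding graph_dist_def
proof (rule Least_equality)
  show "\<exists>\<gamma>\<in>lattice_paths x y. length (path_edges \<gamma>) = l1 (y - x)"
    by (rule ex_lattice_path)
  show "l1 (y - x) \<le> n" if "\<exists>\<gamma>\<in>lattice_paths x y. length (path_edges \<gamma>) = n" for n
    using that lattice_path_l1 by (auto simp: l1_minus[of y])
qed

lemma lattice_ball_l1: "lattice_ball R = {v. l1 v \<le> R}"
  by (simp add: lattice_ball_def graph_dist_eq)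

lemma ball_boundary_l1: "ball_boundary R = {v. l1 v = R}"
  by (simp add: ball_boundary_def graph_dist_eq)

section \<open>Cubes and balls around the origin\<close>

definition cube :: "nat \<Rightarrow> (int ^ 'd::finite) set" where
  "cube L = {v. \<forall>i. \<bar>v $ i\<bar> \<le> int L}"

lemma cube_bij: "bij_betw (vec_nth :: int ^ 'd::finite \<Rightarrow> _) (cube L) (PiE UNIV (\<lambda>_. {- int L..int L}))"
  by (rule bij_betw_byWitness[where f' = vec_lambda]) (auto simp: cube_def vec_lambda_beta abs_le_iff PiE_iff minus_le_iff)

lemma card_cube: "card (cube L :: (int ^ 'd::finite) set) = (2 * L + 1) ^ CARD('d)"
proof -
  have "card (cube L :: (int ^ 'd) set) = (\<Prod>i\<in>(UNIV :: 'd set). card {- int L..int L})"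
    unfolding bij_betw_same_card[OF cube_bij] by (rule card_PiE) simp
  moreover have "card {- int L..int L} = 2 * L + 1"
    by simp
  ultimately show ?thesis by (simp only: prod_constant)
qed

lemma finite_cube [simp]: "finite (cube L)"
  by (rule card_ge_0_finite) (simp add: card_cube)

lemma cube_mono: "L \<le> L' \<Longrightarrow> cube L \<subseteq> cube L'"
  unfolding cube_def by (fastforce intro: order_trans)

lemma cube_neighbour:
  assumes "u \<in> cube L" "lattice_adj u v"
  shows "v \<in> cube (Suc L)"
  unfolding cube_def mem_Collect_eq
proof
  fix i
  have "\<bar>u $ i - v $ i\<bar> \<le> (\<Sum>i\<in>UNIV. \<bar>u $ i - v $ i\<bar>)"
    by (rule member_le_sum) auto
  also have "\<dots> = 1" using assms(2) by (simp add: lattice_adj_def)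
  finally have "\<bar>u $ i - v $ i\<bar> \<le> 1" .
  moreover have "\<bar>u $ i\<bar> \<le> int L" using assms(1) by (simp add: cube_def)
  ultimately show "\<bar>v $ i\<bar> \<le> int (Suc L)" by simp
qed

lemma lattice_ball_subset_cube: "lattice_ball R \<subseteq> cube R"
proof
  fix v :: "int ^ 'd::finite" assume "v \<in> lattice_ball R"
  then have "int (l1 v) \<le> int R" by (simp add: lattice_ball_l1)
  moreover have "\<bar>v $ i\<bar> \<le> int (l1 v)" for i
    unfolding int_l1 by (rule member_le_sum) auto
  ultimately show "v \<in> cube R" unfolding cube_def using order_trans by blast
qed

lemma finite_lattice_ball [simp]: "finite (lattice_ball R :: (int ^ 'd::finite) set)"
  by (rule finite_subset[OF lattice_ball_subset_cube]) simp

lemma finite_ball_edges [simp]: "finite (ball_edges R :: (int ^ 'd::finite) set set)"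
  by (rule finite_subset[of _ "Pow (lattice_ball R)"]) (auto simp: ball_edges_def)

lemma ball_boundary_subset: "ball_boundary R \<subseteq> lattice_ball R"
  by (auto simp: ball_boundary_def lattice_ball_def)

lemma finite_ball_boundary [simp]: "finite (ball_boundary R :: (int ^ 'd::finite) set)"
  by (rule finite_subset[OF ball_boundary_subset]) simp

lemma ball_boundary_nonempty [simp]: "ball_boundary R \<noteq> ({} :: (int ^ 'd::finite) set)"
proof -
  \<comment> \<open>\<open>undefined\<close> stands for an arbitrary coordinate direction.\<close>
  have "axis undefined (int R) \<in> (ball_boundary R :: (int ^ 'd) set)"
    by (simp add: ball_boundary_l1)
  then show ?thesis by blast
qed

lemma ball_edges_lattice: "ball_edges R \<subseteq> lattice_edges"
  by (auto simp: ball_edges_def)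

lemma card_ball_edges_ge: "R \<le> card (ball_edges R :: (int ^ 'd::finite) set set)"
proof -
  define f :: "nat \<Rightarrow> (int ^ 'd) set"
    where "f k = {axis undefined (int k), axis undefined (int (Suc k))}" for k
  have axis_diff: "axis i a - axis i b = (axis i (a - b) :: int ^ 'd)" for i a b
    by (simp add: axis_def vec_eq_iff)
  have "inj_on f {..<R}"
    by (auto simp: inj_on_def f_def doubleton_eq_iff axis_eq_axis)
  moreover have "f ` {..<R} \<subseteq> ball_edges R"
    by (auto simp: f_def ball_edges_def lattice_adj_l1 axis_diff lattice_ball_l1)
  ultimately have "card {..<R} \<le> card (ball_edges R :: (int ^ 'd) set set)"
    by (intro card_inj_on_le) auto
  then show ?thesis by simp
qed

subsection \<open>Components of a subgraph\<close>

text \<open>\<open>lattice_adj\<close> is required besides membership in \<open>S\<close>, because a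
  set such as \<open>{e. w e < p}\<close> may contain non-edges, where \<open>w\<close> takes the
  value \<open>undefined\<close>.\<close>

definition links :: "(int ^ 'd) set set \<Rightarrow> ((int ^ 'd) \<times> (int ^ 'd)) set" where
  "links S = {(x, y). lattice_adj x y \<and> {x, y} \<in> S}"

definition component :: "(int ^ 'd) set set \<Rightarrow> int ^ 'd \<Rightarrow> (int ^ 'd) set" where
  "component S x = {y. (x, y) \<in> (links S)\<^sup>*}"

lemma component_refl [simp]: "x \<in> component S x"
  by (simp add: component_def)

lemma component_step: "y \<in> component S x \<Longrightarrow> lattice_adj y z \<Longrightarrow> {y, z} \<in> S \<Longrightarrow> z \<in> component S x"
  by (auto simp: component_def links_def intro: rtrancl_into_rtrancl)

lemma component_induct [consumes 1, case_names refl step]: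
  assumes "y \<in> component S x" "P x"
    "\<And>y z. y \<in> component S x \<Longrightarrow> lattice_adj y z \<Longrightarrow> {y, z} \<in> S \<Longrightarrow> P y \<Longrightarrow> P z"
  shows "P y"
  using assms(1) unfolding component_def mem_Collect_eq
  by (induction rule: rtrancl_induct) (use assms in \<open>auto simp: component_def links_def\<close>)

lemma component_trans: "y \<in> component S x \<Longrightarrow> z \<in> component S y \<Longrightarrow> z \<in> component S x"
  by (auto simp: component_def)

lemma component_sym: "y \<in> component S x \<Longrightarrow> x \<in> component S y"
proof -
  have "sym (links S)"
    by (auto simp: sym_def links_def lattice_adj_sym insert_commute)
  then show "y \<in> component S x \<Longrightarrow> x \<in> component S y"
    using sym_rtrancl[of "links S"] by (auto simp: component_def sym_def)
qed

lemma component_eq: "y \<in> component S x \<Longrightarrow> component S y = component S x"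
  by (meson component_sym component_trans subsetI subset_antisym)

lemma component_mono: "S \<subseteq> T \<Longrightarrow> component S x \<subseteq> component T x"
  unfolding component_def using rtrancl_mono[of "links S" "links T"] by (auto simp: links_def)

text \<open>Bridges the closure form, suited to induction and finite relation powers, and the path
  form, suited to passage times and countable unions.\<close>

lemma component_path_iff: "y \<in> component S x \<longleftrightarrow> (\<exists>\<gamma>\<in>lattice_paths x y. set (path_edges \<gamma>) \<subseteq> S)"
proof
  assume "y \<in> component S x"
  then show "\<exists>\<gamma>\<in>lattice_paths x y. set (path_edges \<gamma>) \<subseteq> S"
  proof (induction rule: component_induct)
    case refl
    then show ?case by (intro bexI[of _ "[x]"]) auto
  next
    case (step y z)
    then obtain \<gamma> where "\<gamma> \<in> lattice_paths x y" "set (path_edges \<gamma>) \<subseteq> S" by blast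
    with step show ?case
      by (intro bexI[of _ "\<gamma> @ [z]"]) (auto simp: lattice_path_extend)
  qed
next
  assume "\<exists>\<gamma>\<in>lattice_paths x y. set (path_edges \<gamma>) \<subseteq> S"
  then obtain \<gamma> where "\<gamma> \<in> lattice_paths x y" "set (path_edges \<gamma>) \<subseteq> S" by blast
  then show "y \<in> component S x"
    by (induction rule: lattice_path_induct) (auto simp: lattice_path_extend intro: component_step)
qed

lemma cluster_eq_component: "cluster w p x = component {e. w e < p} x"
  unfolding cluster_def set_eq_iff mem_Collect_eq component_path_iff subset_eq by blast

lemma component_exit:
  assumes "y \<in> component S x" "x \<in> A" "y \<notin> A"
  obtains u v where "u \<in> component S x" "u \<in> A" "v \<notin> A" "lattice_adj u v" "{u, v} \<in> S"
proof -
  have "y \<in> A \<or> (\<exists>u v. u \<in> component S x \<and> u \<in> A \<and> v \<notin> A \<and> lattice_adj u v \<and> {u, v} \<in> S)"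
    using assms(1) by (induction rule: component_induct) (use assms(2) in blast)+
  with assms(3) that show ?thesis by blast
qed

text \<open>Restart the connection at each use of an edge in \<open>F\<close>: its endpoint lies in
  \<open>B\<close>, so what follows the last such edge starts in \<open>B\<close> and avoids
  \<open>F\<close>.\<close>

lemma component_last_visit:
  assumes "y \<in> component S x" "F \<subseteq> Pow B"
  shows "y \<in> component (S - F) x \<or> (\<exists>b\<in>B. b \<in> component S x \<and> y \<in> component (S - F) b)"
  using assms(1)
proof (induction rule: component_induct)
  case (step y z)
  have z: "z \<in> component S x" using step by (auto intro: component_step)
  show ?case
  proof (cases "{y, z} \<in> F")
    case True
    then have "z \<in> B" using assms(2) by auto
    with z show ?thesis by auto
  next
    case False
    with step show ?thesis by (auto intro: component_step)
  qed
qed simp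

text \<open>Finitely many pieces started in \<open>B\<close> cover the component, so one of them is
  infinite: deleting finitely many edges cannot destroy an infinite cluster completely.\<close>

lemma infinite_component_last_visit:
  assumes "infinite (component S x)" "F \<subseteq> Pow B" "finite B" "x \<in> B"
  obtains b where "b \<in> B" "b \<in> component S x" "infinite (component (S - F) b)"
proof -
  have "component S x \<subseteq> (\<Union>b\<in>B \<inter> component S x. component (S - F) b)"
    using component_last_visit[OF _ assms(2)] assms(4) by fastforce
  then have "infinite (\<Union>b\<in>B \<inter> component S x. component (S - F) b)"
    using assms(1) finite_subset by blast
  then show ?thesis using that assms(3) by auto
qed

lemma component_cong:
  assumes "\<And>e. e \<in> lattice_edges \<Longrightarrow> e \<in> S \<longleftrightarrow> e \<in> T"
  shows "component S x = component T x"
  using assms by (simp add: component_def links_def cong: conj_cong)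

lemma component_avoid:
  assumes "y \<in> component S x" "\<forall>b\<in>B. b \<notin> component S x" "F \<subseteq> Pow B"
  shows "y \<in> component (S - F) x"
  using assms(1)
proof (induction rule: component_induct)
  case (step y z)
  then have "y \<notin> B" using assms(2) by blast
  then have "{y, z} \<notin> F" using assms(3) by blast
  with step show ?case by (auto intro: component_step)
qed simp

lemma component_within:
  assumes "\<And>u v. u \<in> component S x \<Longrightarrow> lattice_adj u v \<Longrightarrow> {u, v} \<in> T \<Longrightarrow> {u, v} \<in> S"
  shows "component T x \<subseteq> component S x"
proof
  fix y assume "y \<in> component T x"
  then show "y \<in> component S x"
    by (induction rule: component_induct) (auto intro: component_step assms)
qed

lemma ball_connected:
  fixes x :: "int ^ 'd::finite"
  assumes "x \<in> lattice_ball n"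
  shows "x \<in> component (ball_edges n) 0"
  using assms
proof (induction "l1 x" arbitrary: x)
  case (Suc k)
  then have "x \<noteq> 0" by auto
  then obtain u where u: "lattice_adj x u" "l1 x = Suc (l1 u)" by (rule l1_closer)
  then have "u \<in> component (ball_edges n) 0"
    using Suc by (auto simp: lattice_ball_l1)
  moreover have ux: "lattice_adj u x"
    using u(1) by (simp only: lattice_adj_sym)
  moreover have "{u, x} \<in> ball_edges n"
    using ux u(2) Suc.prems by (simp add: ball_edges_def lattice_ball_l1)
  ultimately show ?case by (rule component_step)
qed simp

subsection \<open>Translations\<close>

lemma component_shift: "component ((`) (\<lambda>v. v + a) ` S) (x + a) = (\<lambda>v. v + a) ` component S x"
proof -
  have *: "y + a \<in> component ((`) (\<lambda>v. v + a) ` S) (x + a)" if "y \<in> component S x" for S x y and a :: "int ^ 'a"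
    using that
  proof (induction rule: component_induct)
    case (step y z)
    have "(\<lambda>v. v + a) ` {y, z} \<in> (`) (\<lambda>v. v + a) ` S"
      by (rule imageI) (rule step)
    then have "{y + a, z + a} \<in> (`) (\<lambda>v. v + a) ` S" by simp
    moreover have "lattice_adj (y + a) (z + a)" using step by simp
    ultimately show ?case using step.IH by (blast intro: component_step)
  qed simp
  have "y \<in> (\<lambda>v. v + a) ` component S x" if "y \<in> component ((`) (\<lambda>v. v + a) ` S) (x + a)" for y
  proof -
    have "y - a \<in> component S x"
      using *[OF that, of "-a"] by (simp add: image_image)
    then show ?thesis by (rule rev_image_eqI) simp
  qed
  with * show ?thesis by blast
qed

section \<open>Balls around arbitrary centers\<close>

definition sball :: "int ^ 'd \<Rightarrow> nat \<Rightarrow> (int ^ 'd) set" where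
  "sball x n = (\<lambda>v. v + x) ` lattice_ball n"

definition sball_edges :: "int ^ 'd \<Rightarrow> nat \<Rightarrow> (int ^ 'd) set set" where
  "sball_edges x n = (`) (\<lambda>v. v + x) ` ball_edges n"

lemma mem_sball: "y \<in> sball x n \<longleftrightarrow> l1 (y - x) \<le> n"
proof -
  have "y \<in> sball x n \<longleftrightarrow> y - x \<in> lattice_ball n"
    unfolding sball_def by (metis (no_types, lifting) add_diff_cancel_right' diff_add_cancel image_iff)
  then show ?thesis by (simp add: lattice_ball_l1)
qed

lemma sball_0 [simp]: "sball 0 n = lattice_ball n"
  by (simp add: sball_def)

lemma sball_edges_0 [simp]: "sball_edges 0 n = ball_edges n"
  by (simp add: sball_edges_def)

lemma finite_sball [simp]: "finite (sball x n :: (int ^ 'd::finite) set)"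
  by (simp add: sball_def)

lemma center_sball [simp]: "x \<in> sball x n"
  by (simp add: mem_sball)

lemma finite_sball_edges [simp]: "finite (sball_edges x n :: (int ^ 'd::finite) set set)"
  by (simp add: sball_edges_def)

lemma card_sball_edges:
  "card (sball_edges (x :: int ^ 'd) n) = card (ball_edges n :: (int ^ 'd) set set)"
proof -
  have "inj (\<lambda>v. v + x)" by (simp add: inj_on_def)
  then have "inj_on ((`) (\<lambda>v. v + x)) (ball_edges n)"
    by (simp add: inj_on_def inj_image_eq_iff)
  then show ?thesis
    unfolding sball_edges_def by (rule card_image)
qed

lemma sball_edges_eq: "sball_edges x n = {e \<in> lattice_edges. e \<subseteq> sball x n}" (is "?L = ?R")
proof
  show "?L \<subseteq> ?R"
  proof
    fix e assume "e \<in> ?L"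
    then obtain u v where "e = {u + x, v + x}" "lattice_adj u v" "u \<in> lattice_ball n" "v \<in> lattice_ball n"
      by (auto simp: sball_edges_def ball_edges_def lattice_edges_def)
    then show "e \<in> ?R"
      by (auto simp: sball_def)
  qed
  show "?R \<subseteq> ?L"
  proof
    fix e assume "e \<in> ?R"
    then obtain u v where e: "e = {u, v}" "lattice_adj u v" "u \<in> sball x n" "v \<in> sball x n"
      by (auto simp: lattice_edges_def)
    then have "{u - x, v - x} \<in> ball_edges n"
      using lattice_adj_add[of u "-x" v] by (auto simp: ball_edges_def mem_sball lattice_ball_l1)
    then show "e \<in> ?L"
      unfolding sball_edges_def e by (rule rev_image_eqI) simp
  qed
qed

lemma sball_edges_lattice: "sball_edges x n \<subseteq> lattice_edges"
  by (auto simp: sball_edges_eq)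

lemma sball_edges_Pow: "sball_edges x n \<subseteq> Pow (sball x n)"
  by (auto simp: sball_edges_eq)

lemma sball_mono: "m \<le> n \<Longrightarrow> sball x m \<subseteq> sball x n"
  by (auto simp: mem_sball)

lemma sball_connected:
  fixes x :: "int ^ 'd::finite"
  assumes "y \<in> sball x n"
  shows "y \<in> component (sball_edges x n) x"
proof -
  obtain v where "v \<in> lattice_ball n" "y = v + x" using assms by (auto simp: sball_def)
  then show ?thesis
    using ball_connected[of v n] component_shift[of x "ball_edges n" 0] by (auto simp: sball_edges_def)
qed

lemma sball_connected2:
  fixes x :: "int ^ 'd::finite"
  assumes "y \<in> sball x n" "z \<in> sball x n" "sball_edges x n \<subseteq> S"
  shows "z \<in> component S y"
proof -
  have "y \<in> component S x" "z \<in> component S x"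
    using assms sball_connected component_mono by blast+
  then show ?thesis by (meson component_sym component_trans)
qed

section \<open>The weight space\<close>

abbreviation unif :: "real measure" where
  "unif \<equiv> uniform_measure lborel {0..1}"

lemma prob_space_unif: "prob_space unif"
  by (rule prob_space_uniform_measure) auto

lemma prob_space_weight_space: "prob_space weight_space"
  unfolding weight_space_def by (rule prob_space_PiM) (rule prob_space_unif)

interpretation W: prob_space "weight_space :: ((int ^ 'd::finite) set \<Rightarrow> real) measure"
  by (rule prob_space_weight_space)

lemma space_weight_space: "space weight_space = (\<Pi>\<^sub>E e\<in>lattice_edges. UNIV)"
  by (simp add: weight_space_def space_PiM)

lemma weight_space_undefined: "w \<in> space weight_space \<Longrightarrow> e \<notin> lattice_edges \<Longrightarrow> w e = undefined"
  by (auto simp: space_weight_space PiE_def extensional_def)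

text \<open>Holds for every set \<open>e\<close>: off the lattice edges the coordinate is constantly
  \<open>undefined\<close>. Events built from arbitrary \<open>e\<close> are then measurable without
  a side condition.\<close>

lemma measurable_weight [measurable]: "(\<lambda>w. w e) \<in> borel_measurable weight_space"
proof (cases "e \<in> lattice_edges")
  case True
  have "sets unif = sets borel" by simp
  then show ?thesis
    using measurable_component_singleton[OF True, of "\<lambda>_. unif"]
    by (simp add: weight_space_def cong: measurable_cong_sets)
next
  case False
  show ?thesis
    by (subst measurable_cong[where g = "\<lambda>_. undefined"]) (auto simp: False weight_space_undefined)
qed

lemma weight_prob_eq_0:
  fixes Q :: "((int ^ 'd::finite) set \<Rightarrow> real) \<Rightarrow> bool"
  assumes [measurable]: "Measurable.pred weight_space Q"
  shows "\<P>(w in weight_space. Q w) = 0 \<longleftrightarrow> (AE w in weight_space. \<not> Q w)"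
  by (subst W.prob_eq_0) (auto intro!: AE_cong)

lemma weight_prob_not:
  fixes Q :: "((int ^ 'd::finite) set \<Rightarrow> real) \<Rightarrow> bool"
  assumes [measurable]: "Measurable.pred weight_space Q"
  shows "\<P>(w in weight_space. \<not> Q w) = 1 - \<P>(w in weight_space. Q w)"
  using W.prob_neg[of Q] by simp

text \<open>Continuity from below, in the form in which most radii, scales and thresholds are
  chosen.\<close>

lemma prob_incseq_eventually:
  fixes Q :: "nat \<Rightarrow> ((int ^ 'd::finite) set \<Rightarrow> real) \<Rightarrow> bool"
  assumes [measurable]: "\<And>k. Measurable.pred weight_space (Q k)"
    and mono: "\<And>j k w. j \<le> k \<Longrightarrow> Q j w \<Longrightarrow> Q k w"
    and "a < \<P>(w in weight_space. \<exists>k. Q k w)"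
  shows "\<forall>\<^sub>F k in sequentially. a < \<P>(w in weight_space. Q k w)"
proof (rule order_tendstoD(1))
  have "(\<lambda>k. \<P>(w in weight_space. Q k w)) \<longlonglongrightarrow> W.prob (\<Union>k. {w \<in> space weight_space. Q k w})"
    using mono by (intro W.finite_Lim_measure_incseq) (auto simp: incseq_def)
  also have "(\<Union>k. {w \<in> space weight_space. Q k w}) = {w \<in> space weight_space. \<exists>k. Q k w}" by auto
  finally show "(\<lambda>k. \<P>(w in weight_space. Q k w)) \<longlonglongrightarrow> \<P>(w in weight_space. \<exists>k. Q k w)" .
qed (rule assms(3))

lemma AE_weight:
  assumes "e \<in> lattice_edges" "AE x in unif. P x"
  shows "AE w in weight_space. P (w e)"
  unfolding weight_space_def using assms prob_space_unif by (intro AE_PiM_component) auto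

lemma AE_unif: "(AE x in lborel. 0 \<le> x \<longrightarrow> x \<le> 1 \<longrightarrow> P x) \<Longrightarrow> AE x in unif. P x"
  by (rule AE_uniform_measureI) auto

lemma AE_all_weights:
  assumes "AE x in lborel. 0 \<le> x \<longrightarrow> x \<le> 1 \<longrightarrow> P x"
  shows "AE w in weight_space :: ((int ^ 'd::finite) set \<Rightarrow> real) measure. \<forall>e\<in>lattice_edges. P (w e)"
  using assms by (subst AE_ball_countable) (auto intro: AE_weight AE_unif)

lemma AE_weight_nonneg:
  "AE w in weight_space :: ((int ^ 'd::finite) set \<Rightarrow> real) measure. \<forall>e\<in>lattice_edges. 0 \<le> w e"
  by (rule AE_all_weights) simp

lemma AE_weight_less_1:
  "AE w in weight_space :: ((int ^ 'd::finite) set \<Rightarrow> real) measure. \<forall>e\<in>lattice_edges. w e < 1"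
  by (rule AE_all_weights) (use AE_lborel_singleton[of "1::real"] in \<open>auto elim!: eventually_mono\<close>)

lemma AE_weight_neq:
  "AE w in weight_space :: ((int ^ 'd::finite) set \<Rightarrow> real) measure. \<forall>e\<in>lattice_edges. w e \<noteq> c"
  by (rule AE_all_weights) (use AE_lborel_singleton[of c] in \<open>auto elim!: eventually_mono\<close>)

lemma unif_less:
  assumes "0 \<le> p" "p \<le> 1"
  shows "emeasure unif {..<p} = ennreal p"
proof -
  have "{0..1} \<inter> {..<p} = {0..<p}" using assms by auto
  then show ?thesis using assms by (simp add: divide_ennreal_def)
qed

lemma prob_all_open:
  fixes F :: "(int ^ 'd::finite) set set"
  assumes "0 \<le> p" "p \<le> 1" "finite F" "F \<subseteq> lattice_edges"
  shows "\<P>(w in weight_space. \<forall>e\<in>F. w e < p) = p ^ card F"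
proof -
  have "{w \<in> space weight_space. \<forall>e\<in>F. w e < p}
      = prod_emb lattice_edges (\<lambda>_. unif) F (PiE F (\<lambda>_. {..<p}))"
    using assms(4) by (auto simp: prod_emb_def space_weight_space space_PiM PiE_iff extensional_def)
  also have "emeasure weight_space \<dots> = (\<Prod>e\<in>F. emeasure unif {..<p})"
    unfolding weight_space_def using assms prob_space_unif by (intro emeasure_PiM_emb) auto
  also have "\<dots> = ennreal (p ^ card F)"
    unfolding unif_less[OF assms(1,2)] using assms by (simp add: ennreal_power)
  finally show ?thesis
    using assms by (simp add: measure_def)
qed

subsection \<open>Independence of disjoint sets of edges\<close>

lemma indep_weights:
  "W.indep_vars (\<lambda>_. unif) (\<lambda>e w. w e) (lattice_edges :: (int ^ 'd::finite) set set)"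
proof -
  let ?M = "weight_space :: ((int ^ 'd) set \<Rightarrow> real) measure"
  \<comment> \<open>The product criterion for independence requires a nonempty index set.\<close>
  have ne: "lattice_edges \<noteq> ({} :: (int ^ 'd) set set)"
    using edge_in_lattice_edges[of "axis undefined 1" "0 :: int ^ 'd"]
    by (auto simp: lattice_adj_l1 simp del: edge_in_lattice_edges)
  have "distr ?M (\<Pi>\<^sub>M e\<in>lattice_edges. unif) (\<lambda>w. \<lambda>e\<in>lattice_edges. w e)
      = distr ?M ?M (\<lambda>w. w)"
    unfolding weight_space_def
    by (rule distr_cong) (auto simp: space_PiM PiE_def extensional_restrict)
  also have "\<dots> = ?M" by simp
  also have "\<dots> = (\<Pi>\<^sub>M e\<in>lattice_edges. distr ?M unif (\<lambda>w. w e))"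
    unfolding weight_space_def
    by (intro PiM_cong refl distr_PiM_component[symmetric] prob_space_unif)
  finally show ?thesis
    using ne by (subst W.indep_vars_iff_distr_eq_PiM') auto
qed

text \<open>Expresses that \<open>A\<close> is determined by the edges outside \<open>F\<close>. One
  implication suffices, since the two configurations may be exchanged.\<close>

definition ignores :: "((int ^ 'd) set \<Rightarrow> real) set \<Rightarrow> (int ^ 'd) set set \<Rightarrow> bool" where
  "ignores A F \<longleftrightarrow> (\<forall>w\<in>space weight_space. \<forall>w'\<in>space weight_space.
     (\<forall>e\<in>lattice_edges - F. w e = w' e) \<longrightarrow> w \<in> A \<longrightarrow> w' \<in> A)"

lemma ignoresI:
  assumes "\<And>w w'. \<forall>e\<in>lattice_edges - F. w e = w' e \<Longrightarrow> Q w \<Longrightarrow> Q w'"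
  shows "ignores {w \<in> space weight_space. Q w} F"
  using assms unfolding ignores_def by blast

lemma prob_Int_ignores:
  fixes A :: "((int ^ 'd::finite) set \<Rightarrow> real) set"
  assumes A: "A \<in> sets weight_space" "ignores A F"
    and F: "finite F" "F \<subseteq> lattice_edges" and X: "\<And>e. e \<in> F \<Longrightarrow> X e \<in> sets borel"
  shows "W.prob (A \<inter> {w \<in> space weight_space. \<forall>e\<in>F. w e \<in> X e})
       = W.prob A * \<P>(w in weight_space. \<forall>e\<in>F. w e \<in> X e)"
proof -
  let ?M = "weight_space :: ((int ^ 'd) set \<Rightarrow> real) measure"
  let ?G = "lattice_edges - F"
  \<comment> \<open>\<open>ext\<close> fills the coordinates in \<open>F\<close> with 0. As
    \<open>A\<close> ignores \<open>F\<close>, the filling does not affect membership, so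
    \<open>A\<close> is the preimage of \<open>AG\<close> under restriction to the other
    edges.\<close>
  define ext :: "((int ^ 'd) set \<Rightarrow> real) \<Rightarrow> (int ^ 'd) set \<Rightarrow> real"
    where "ext v = (\<lambda>e\<in>lattice_edges. if e \<in> F then 0 else v e)" for v
  define XF where "XF = PiE F X"
  define AG where "AG = ext -` A \<inter> space (\<Pi>\<^sub>M e\<in>?G. unif)"
  have ext: "ext \<in> (\<Pi>\<^sub>M e\<in>?G. unif) \<rightarrow>\<^sub>M ?M"
    unfolding ext_def[abs_def] weight_space_def
  proof (rule measurable_restrict)
    fix e :: "(int ^ 'd) set" assume "e \<in> lattice_edges"
    then show "(\<lambda>v. if e \<in> F then 0 else v e) \<in> (\<Pi>\<^sub>M e\<in>?G. unif) \<rightarrow>\<^sub>M unif"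
      by (cases "e \<in> F") (auto intro: measurable_component_singleton)
  qed
  have indep: "W.indep_var (\<Pi>\<^sub>M e\<in>F. unif) (\<lambda>w. restrict (\<lambda>e. w e) F)
      (\<Pi>\<^sub>M e\<in>?G. unif) (\<lambda>w. restrict (\<lambda>e. w e) ?G)"
    using F by (intro W.indep_var_restrict[OF indep_weights]) auto
  have XF: "XF \<in> sets (\<Pi>\<^sub>M e\<in>F. unif)"
    unfolding XF_def using F X by (intro sets_PiM_I_finite) auto
  have AG: "AG \<in> sets (\<Pi>\<^sub>M e\<in>?G. unif)"
    unfolding AG_def using ext A(1) by (rule measurable_sets)
  have 1: "(\<lambda>w. restrict (\<lambda>e. w e) F) -` XF \<inter> space ?M = {w \<in> space ?M. \<forall>e\<in>F. w e \<in> X e}"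
    by (auto simp: XF_def PiE_iff)
  have mem: "ext (restrict w ?G) \<in> A \<longleftrightarrow> w \<in> A" if "w \<in> space ?M" for w
  proof -
    have "ext (restrict w ?G) \<in> space ?M"
      by (auto simp: ext_def space_weight_space)
    moreover have "\<forall>e\<in>?G. ext (restrict w ?G) e = w e"
      by (auto simp: ext_def)
    ultimately show ?thesis
      using A(2) that unfolding ignores_def by metis
  qed
  have 2: "(\<lambda>w. restrict (\<lambda>e. w e) ?G) -` AG \<inter> space ?M = A"
    using sets.sets_into_space[OF A(1)] mem by (auto simp: AG_def space_PiM)
  have "W.prob ((\<lambda>w. (restrict (\<lambda>e. w e) F, restrict (\<lambda>e. w e) ?G)) -` (XF \<times> AG) \<inter> space ?M)
      = \<P>(w in weight_space. \<forall>e\<in>F. w e \<in> X e) * W.prob A"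
    using W.indep_varD[OF indep XF AG] unfolding 1 2 .
  also have "(\<lambda>w. (restrict (\<lambda>e. w e) F, restrict (\<lambda>e. w e) ?G)) -` (XF \<times> AG) \<inter> space ?M
      = ((\<lambda>w. restrict (\<lambda>e. w e) F) -` XF \<inter> space ?M) \<inter>
        ((\<lambda>w. restrict (\<lambda>e. w e) ?G) -` AG \<inter> space ?M)"
    by auto
  finally show ?thesis
    unfolding 1 2 by (simp add: Int_commute mult.commute)
qed

text \<open>Finite energy: by independence, opening \<open>F\<close> on top of \<open>A\<close>
  costs exactly the factor \<open>p ^ card F\<close>, which is the same for all translates of a
  ball.\<close>

lemma prob_open_ignores:
  fixes A :: "((int ^ 'd::finite) set \<Rightarrow> real) set"
  assumes "A \<in> sets weight_space" "ignores A F" "finite F" "F \<subseteq> lattice_edges" "0 \<le> p" "p \<le> 1"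
    and B: "B \<in> sets weight_space"
    and sub: "\<And>w. w \<in> A \<Longrightarrow> \<forall>e\<in>F. w e < p \<Longrightarrow> w \<in> B"
  shows "p ^ card F * W.prob A \<le> W.prob B"
proof -
  have "p ^ card F * W.prob A = W.prob (A \<inter> {w \<in> space weight_space. \<forall>e\<in>F. w e \<in> {..<p}})"
    using prob_Int_ignores[OF assms(1-4), of "\<lambda>_. {..<p}"] prob_all_open[OF assms(5,6,3,4)]
    by simp
  also have "\<dots> \<le> W.prob B"
    using sub by (intro W.finite_measure_mono B) auto
  finally show ?thesis .
qed

text \<open>Conditioning on \<open>A\<close> leaves every finite-dimensional cylinder probability
  unchanged, so the conditional measure is the original one; and it gives \<open>A\<close> mass
  1.\<close>

lemma zero_one_law:
  fixes A :: "((int ^ 'd::finite) set \<Rightarrow> real) set"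
  assumes A: "A \<in> sets weight_space"
    and ignores: "\<And>F. finite F \<Longrightarrow> F \<subseteq> lattice_edges \<Longrightarrow> ignores A F"
  shows "W.prob A = 0 \<or> W.prob A = 1"
proof (cases "W.prob A = 0")
  case False
  let ?M = "weight_space :: ((int ^ 'd) set \<Rightarrow> real) measure"
  have A0: "emeasure ?M A \<noteq> 0" "emeasure ?M A \<noteq> \<infinity>"
    using False by (auto simp: W.emeasure_eq_measure)
  interpret U: prob_space "uniform_measure ?M A"
    using A0 by (rule prob_space_uniform_measure)
  have "uniform_measure ?M A = ?M"
    unfolding weight_space_def
  proof (rule measure_eqI_PiM_infinite; fold weight_space_def)
    show "finite_measure (uniform_measure ?M A)" by (rule U.finite_measure_axioms)
  next
    fix X :: "(int ^ 'd) set \<Rightarrow> real set" and J :: "(int ^ 'd) set set"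
    assume J: "finite J" "J \<subseteq> lattice_edges" and X: "\<And>i. i \<in> J \<Longrightarrow> X i \<in> sets unif"
    have eq: "prod_emb lattice_edges (\<lambda>_. unif) J (Pi\<^sub>E J X) = {w \<in> space ?M. \<forall>e\<in>J. w e \<in> X e}"
      using J by (auto simp: prod_emb_def space_weight_space space_PiM PiE_iff extensional_def)
    have m: "prod_emb lattice_edges (\<lambda>_. unif) J (Pi\<^sub>E J X) \<in> sets ?M"
      unfolding weight_space_def using J X by (intro sets_PiM_I) auto
    have "measure (uniform_measure ?M A) (prod_emb lattice_edges (\<lambda>_. unif) J (Pi\<^sub>E J X))
        = W.prob (prod_emb lattice_edges (\<lambda>_. unif) J (Pi\<^sub>E J X))"
      using prob_Int_ignores[OF A ignores[OF J] J, of X] X False A0 m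
      unfolding eq by simp
    then show "emeasure (uniform_measure ?M A) (prod_emb lattice_edges (\<lambda>_. unif) J (Pi\<^sub>E J X))
        = emeasure ?M (prod_emb lattice_edges (\<lambda>_. unif) J (Pi\<^sub>E J X))"
      by (simp add: U.emeasure_eq_measure W.emeasure_eq_measure)
  qed (auto simp: weight_space_def)
  then have "emeasure ?M A = 1"
    using emeasure_uniform_measure_1[OF A0] by simp
  then show ?thesis by (simp add: W.emeasure_eq_measure)
qed simp

subsection \<open>Translation invariance\<close>

text \<open>The environment seen from \<open>a\<close>: vertex \<open>x\<close> in
  \<open>shift a w\<close> plays the role of \<open>x + a\<close> in \<open>w\<close>. The
  restriction keeps the result in the extensional product space.\<close>

definition shift :: "int ^ 'd \<Rightarrow> ((int ^ 'd) set \<Rightarrow> real) \<Rightarrow> (int ^ 'd) set \<Rightarrow> real" where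
  "shift a w = (\<lambda>e\<in>lattice_edges. w ((\<lambda>v. v + a) ` e))"

lemma shift_edge_lattice: "e \<in> lattice_edges \<Longrightarrow> (\<lambda>v. v + a) ` e \<in> lattice_edges"
proof -
  assume "e \<in> lattice_edges"
  then obtain x y where "e = {x, y}" "lattice_adj x y" by (auto simp: lattice_edges_def)
  then show ?thesis by simp
qed

lemma distr_shift:
  fixes a :: "int ^ 'd::finite"
  shows "distr weight_space weight_space (shift a) = weight_space"
    and measurable_shift [measurable]: "shift a \<in> weight_space \<rightarrow>\<^sub>M weight_space"
proof -
  have "inj (\<lambda>v. v + a)" by (simp add: inj_on_def)
  then have "inj_on ((`) (\<lambda>v. v + a)) lattice_edges"
    by (simp add: inj_on_def inj_image_eq_iff)
  then show "distr weight_space weight_space (shift a) = weight_space"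
    unfolding weight_space_def shift_def[abs_def]
    by (intro distr_PiM_reindex prob_space_unif) (auto intro: shift_edge_lattice)
  show "shift a \<in> weight_space \<rightarrow>\<^sub>M weight_space"
    unfolding weight_space_def shift_def[abs_def]
    by (intro measurable_restrict measurable_component_singleton shift_edge_lattice)
qed

lemma prob_shift:
  fixes a :: "int ^ 'd::finite"
  assumes [measurable]: "Measurable.pred weight_space Q"
  shows "\<P>(w in weight_space. Q (shift a w)) = \<P>(w in weight_space. Q w)"
proof -
  have "\<P>(w in weight_space. Q w)
      = measure (distr weight_space weight_space (shift a)) {w \<in> space weight_space. Q w}"
    by (simp add: distr_shift)
  also have "\<dots> = \<P>(w in weight_space. Q (shift a w))"
    by (subst measure_distr)
       (auto intro!: arg_cong[where f = W.prob] measurable_space[OF measurable_shift])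
  finally show ?thesis by simp
qed

text \<open>General in the edge condition, so as to cover plain thresholds as well as thresholds
  with ball edges deleted.\<close>

lemma component_shift_weights:
  assumes "\<And>e. e \<in> lattice_edges \<Longrightarrow> Q (shift a w) e \<longleftrightarrow> Q' w ((\<lambda>v. v + a) ` e)"
  shows "component {e. Q' w e} (x + a) = (\<lambda>v. v + a) ` component {e. Q (shift a w) e} x"
proof -
  have cong: "component S x = component (S \<inter> lattice_edges) x" for S and x :: "int ^ 'a"
    unfolding component_def links_def by (simp cong: conj_cong)
  have "{e. Q' w e} \<inter> lattice_edges = (`) (\<lambda>v. v + a) ` ({e. Q (shift a w) e} \<inter> lattice_edges)"
  proof (intro equalityI subsetI)
    fix e assume e: "e \<in> {e. Q' w e} \<inter> lattice_edges"
    have "(\<lambda>v. v + a) ` ((\<lambda>v. v + - a) ` e) = e"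
      by (simp add: image_image)
    moreover have "(\<lambda>v. v + - a) ` e \<in> lattice_edges"
      using e by (intro shift_edge_lattice) simp
    ultimately show "e \<in> (`) (\<lambda>v. v + a) ` ({e. Q (shift a w) e} \<inter> lattice_edges)"
      using e assms[of "(\<lambda>v. v + - a) ` e"] by (intro image_eqI[of _ _ "(\<lambda>v. v + - a) ` e"]) auto
  qed (auto simp: assms shift_edge_lattice)
  then show ?thesis
    using cong[of "{e. Q' w e}"] cong[of "{e. Q (shift a w) e}"] component_shift by metis
qed

subsection \<open>Measurability of connection events\<close>

text \<open>Turns infiniteness into a countable condition, hence a measurable one, and supplies a
  radius enclosing a given finite cluster.\<close>

lemma infinite_iff_leaves_balls:
  fixes A :: "(int ^ 'd::finite) set"
  shows "infinite A \<longleftrightarrow> (\<forall>n. \<exists>y. y \<in> A \<and> y \<notin> lattice_ball n)"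
proof
  assume "infinite A"
  then show "\<forall>n. \<exists>y. y \<in> A \<and> y \<notin> lattice_ball n"
    using finite_subset[OF _ finite_lattice_ball] by blast
next
  assume *: "\<forall>n. \<exists>y. y \<in> A \<and> y \<notin> lattice_ball n"
  show "infinite A"
  proof
    assume "finite A"
    then have "\<forall>y\<in>A. l1 y \<le> Max (l1 ` A)" by simp
    with * show False unfolding lattice_ball_l1 by blast
  qed
qed

text \<open>There are only countably many paths from \<open>x\<close> to \<open>y\<close>, each with
  finitely many edges.\<close>

lemma pred_in_component [measurable (raw)]:
  fixes x y :: "int ^ 'd::finite"
  assumes [measurable]: "\<And>e. Measurable.pred M (\<lambda>w. Q w e)"
  shows "Measurable.pred M (\<lambda>w. y \<in> component {e. Q w e} x)"
proof -
  have "(\<lambda>w. y \<in> component {e. Q w e} x)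
      = (\<lambda>w. \<exists>\<gamma>. \<gamma> \<in> lattice_paths x y \<and> (\<forall>e\<in>set (path_edges \<gamma>). Q w e))"
    unfolding component_path_iff subset_eq by auto
  also have "Measurable.pred M \<dots>"
    by measurable
  finally show ?thesis .
qed

lemma pred_infinite_component [measurable (raw)]:
  fixes x :: "int ^ 'd::finite"
  assumes [measurable]: "\<And>e. Measurable.pred M (\<lambda>w. Q w e)"
  shows "Measurable.pred M (\<lambda>w. finite (component {e. Q w e} x))"
proof -
  have "Measurable.pred M (\<lambda>w. \<not> infinite (component {e. Q w e} x))"
    unfolding infinite_iff_leaves_balls by measurable
  then show ?thesis by simp
qed

section \<open>Counting trifurcations\<close>

text \<open>
  Think of \<open>R t x y\<close> as ``\<open>x\<close> and \<open>y\<close> are connected when the piece \<open>t\<close> is removed'' and of \<open>B t\<close> as the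
  vertices of the piece \<open>t\<close>; every piece separates three points of \<open>Y\<close>.
\<close>

lemma card_trifurcations_le:
  fixes R :: "'t \<Rightarrow> 'v \<Rightarrow> 'v \<Rightarrow> bool" and B :: "'t \<Rightarrow> 'v set"
  assumes sym: "\<And>t x y. t \<in> T0 \<Longrightarrow> R t x y \<Longrightarrow> R t y x"
    and trans: "\<And>t x y z. t \<in> T0 \<Longrightarrow> R t x y \<Longrightarrow> R t y z \<Longrightarrow> R t x z"
    and ball: "\<And>t s b b'. t \<in> T0 \<Longrightarrow> s \<in> T0 \<Longrightarrow> t \<noteq> s \<Longrightarrow> b \<in> B s \<Longrightarrow> b' \<in> B s \<Longrightarrow> R t b b'"
    and switch: "\<And>t s x y. t \<in> T0 \<Longrightarrow> s \<in> T0 \<Longrightarrow> t \<noteq> s \<Longrightarrow> R t x y \<Longrightarrow> (\<forall>b\<in>B s. \<not> R t x b) \<Longrightarrow> R s x y"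
    and ne: "\<And>t. t \<in> T0 \<Longrightarrow> B t \<noteq> {}"
    and "finite T" "T \<subseteq> T0" "finite Y"
    and "\<And>t. t \<in> T \<Longrightarrow> \<exists>Z\<subseteq>Y. card Z = 3 \<and> (\<forall>z\<in>Z. \<exists>b\<in>B t. R t z b) \<and>
      (\<forall>z\<in>Z. \<forall>z'\<in>Z. R t z z' \<longrightarrow> z = z')"
  shows "card T \<le> card Y"
  using assms(6-9)
proof (induction "card T" arbitrary: T Y)
  case (Suc k)
  define hit where "hit t y \<longleftrightarrow> (\<exists>b\<in>B t. R t y b)" for t y
  define tri where "tri t Z \<longleftrightarrow> card Z = 3 \<and> (\<forall>z\<in>Z. hit t z) \<and> (\<forall>z\<in>Z. \<forall>z'\<in>Z. R t z z' \<longrightarrow> z = z')"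
    for t Z
  have tri: "\<exists>Z\<subseteq>Y. tri t Z" if "t \<in> T" for t
    using Suc.prems(4)[OF that] unfolding tri_def hit_def by blast
  \<comment> \<open>Each of \<open>x\<close> and \<open>y\<close> can be related to at most one of
    three pairwise unrelated points.\<close>
  have third: "\<exists>z\<in>Z. \<not> R t z x \<and> \<not> R t z y" if t: "t \<in> T0" and Z: "tri t Z" for t Z x y
  proof (rule ccontr)
    assume "\<not> ?thesis"
    then have "Z = {z\<in>Z. R t z x} \<union> {z\<in>Z. R t z y}" by blast
    moreover have "card {z\<in>Z. R t z u} \<le> 1" for u
    proof -
      have "z = z'" if "z \<in> Z" "z' \<in> Z" "R t z u" "R t z' u" for z z'
        using that Z sym[OF t] trans[OF t] unfolding tri_def by blast
      moreover have "finite Z" using Z by (intro card_ge_0_finite) (simp add: tri_def)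
      ultimately show ?thesis
        by (simp add: card_le_Suc0_iff_eq)
    qed
    ultimately have "card Z \<le> 1 + 1"
      by (metis (no_types, lifting) add_mono card_Un_le order_trans)
    then show False using Z by (simp add: tri_def)
  qed
  \<comment> \<open>The other pieces met by the branch of \<open>y\<close> that remains when
    \<open>t\<close> is removed.\<close>
  define beyond where "beyond t y = {s \<in> T. s \<noteq> t \<and> (\<exists>b\<in>B s. R t y b)}" for t y
  define good where "good p \<longleftrightarrow> fst p \<in> T \<and> snd p \<in> Y \<and> hit (fst p) (snd p)" for p
  obtain t0 where t0: "t0 \<in> T" using Suc.hyps(2) by fastforce
  obtain Z0 where Z0: "Z0 \<subseteq> Y" "tri t0 Z0" using tri[OF t0] by blast
  then obtain z0 where "z0 \<in> Z0" by (fastforce simp: tri_def)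
  with Z0 t0 have "good (t0, z0)"
    by (auto simp: good_def tri_def)
  then have ex: "\<exists>p. good p" ..
  \<comment> \<open>A pair with fewest pieces beyond it acts as a leaf of the tree formed by the
    pieces: \<open>t\<close> together with \<open>y\<close> can be pruned.\<close>
  define p where "p = (ARG_MIN (\<lambda>p. card (beyond (fst p) (snd p))) p. good p)"
  obtain t y where ty: "p = (t, y)" by (cases p)
  have "good p"
    using ex arg_min_natI unfolding p_def by fast
  then have t: "t \<in> T" and y: "y \<in> Y" and hit: "hit t y"
    by (auto simp: ty good_def)
  have min: "card (beyond t y) \<le> card (beyond t' y')" if "t' \<in> T" "y' \<in> Y" "hit t' y'" for t' y'
    using arg_min_nat_le[of good "(t', y')" "\<lambda>p. card (beyond (fst p) (snd p))"] that ty
    unfolding p_def[symmetric] by (simp add: good_def)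
  have T0: "s \<in> T \<Longrightarrow> s \<in> T0" for s using Suc.prems(2) by blast
  \<comment> \<open>The whole of \<open>B r\<close> lies in one class of \<open>R s\<close>, so it
    counts as a single point, and \<open>third\<close> leaves a branch of \<open>s\<close> avoiding
    it as well as \<open>u\<close>.\<close>
  have avoid: "\<exists>z\<in>Z. \<not> R s z u \<and> (\<forall>b\<in>B r. \<not> R s z b)"
    if "s \<in> T" "r \<in> T" "r \<noteq> s" "tri s Z" for s r Z u
  proof -
    obtain b where b: "b \<in> B r" using ne[OF T0[OF \<open>r \<in> T\<close>]] by blast
    obtain z where z: "z \<in> Z" "\<not> R s z u" "\<not> R s z b" using third[OF T0[OF \<open>s \<in> T\<close>] \<open>tri s Z\<close>] by blast
    have "\<not> R s z b'" if "b' \<in> B r" for b'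
      using z(3) ball[OF T0[OF \<open>s \<in> T\<close>] T0[OF \<open>r \<in> T\<close>] \<open>r \<noteq> s\<close>[symmetric] that b]
        trans[OF T0[OF \<open>s \<in> T\<close>]] by blast
    with z show ?thesis by blast
  qed
  \<comment> \<open>If some \<open>s\<close> lay beyond \<open>y\<close>, a branch of
    \<open>s\<close> turned away from \<open>t\<close> would see only pieces beyond
    \<open>y\<close>, and no longer \<open>s\<close> itself, against minimality.\<close>
  have empty: "beyond t y = {}"
  proof (rule ccontr)
    assume "beyond t y \<noteq> {}"
    then obtain s b where s: "s \<in> T" "s \<noteq> t" "b \<in> B s" "R t y b" by (auto simp: beyond_def)
    obtain Z where Z: "Z \<subseteq> Y" "tri s Z" using tri[OF s(1)] by blast
    obtain z where z: "z \<in> Z" "\<forall>c\<in>B t. \<not> R s z c"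
      using avoid[OF s(1) t s(2)[symmetric] Z(2)] by blast
    have hz: "hit s z" using Z z by (auto simp: tri_def)
    then obtain b' where b': "b' \<in> B s" "R s z b'" by (auto simp: hit_def)
    have "R t z b'"
      using switch[OF T0[OF s(1)] T0[OF t] s(2) b'(2) z(2)] .
    then have yz: "R t y z"
      using ball[OF T0[OF t] T0[OF s(1)] s(2)[symmetric] s(3) b'(1)] s(4)
        trans[OF T0[OF t]] sym[OF T0[OF t]] by meson
    have sub: "beyond s z \<subseteq> beyond t y"
    proof
      fix r assume "r \<in> beyond s z"
      then obtain c where r: "r \<in> T" "r \<noteq> s" "c \<in> B r" "R s z c" by (auto simp: beyond_def)
      then have "r \<noteq> t" using z(2) by blast
      moreover have "R t z c" using switch[OF T0[OF s(1)] T0[OF t] s(2) r(4) z(2)] .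
      then have "R t y c" using yz trans[OF T0[OF t]] by blast
      ultimately show "r \<in> beyond t y" using r by (auto simp: beyond_def)
    qed
    moreover have "s \<in> beyond t y" using s by (auto simp: beyond_def)
    moreover have "s \<notin> beyond s z" by (auto simp: beyond_def)
    moreover have "finite (beyond t y)" using Suc.prems(1) by (auto simp: beyond_def)
    ultimately have "card (beyond s z) < card (beyond t y)"
      by (intro psubset_card_mono) auto
    then show False using min[OF s(1) _ hz] Z z by force
  qed
  obtain b where b: "b \<in> B t" "R t y b" using hit by (auto simp: hit_def)
  obtain Zt where Zt: "Zt \<subseteq> Y" "tri t Zt" using tri[OF t] by blast
  \<comment> \<open>Pruning \<open>y\<close> costs no other piece its three points: where
    \<open>y\<close> was used, a point \<open>z\<close> in another branch of \<open>t\<close> takes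
    its place, because with \<open>s\<close> removed it is still joined to \<open>y\<close> through
    \<open>B t\<close>.\<close>
  have "\<exists>Z\<subseteq>Y - {y}. tri s Z" if s: "s \<in> T - {t}" for s
  proof -
    obtain Z where Z: "Z \<subseteq> Y" "tri s Z" using tri s by blast
    show ?thesis
    proof (cases "y \<in> Z")
      case False
      with Z show ?thesis by blast
    next
      case True
      have st: "s \<in> T" "s \<noteq> t" using s by auto
      obtain z where z: "z \<in> Zt" "\<not> R t z y" "\<forall>c\<in>B s. \<not> R t z c"
        using avoid[OF t st(1,2) Zt(2)] by blast
      obtain b2 where b2: "b2 \<in> B t" "R t z b2" using Zt z by (auto simp: tri_def hit_def)
      have "\<forall>c\<in>B s. \<not> R t y c" using empty st by (auto simp: beyond_def)
      then have "R s y b"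
        using switch[OF T0[OF t] T0[OF st(1)] st(2)[symmetric] b(2)] by blast
      moreover have "R s z b2"
        using switch[OF T0[OF t] T0[OF st(1)] st(2)[symmetric] b2(2) z(3)] .
      moreover have "R s b b2" using ball[OF T0[OF st(1)] T0[OF t] st(2) b(1) b2(1)] .
      ultimately have zy: "R s z y" "R s y z" "R s y y"
        using trans[OF T0[OF st(1)]] sym[OF T0[OF st(1)]] by meson+
      have "z \<noteq> y" using z(2) b(2) trans[OF T0[OF t]] sym[OF T0[OF t]] by blast
      have zZ: "z \<notin> Z" using Z True zy \<open>z \<noteq> y\<close> unfolding tri_def by blast
      have "card (insert z (Z - {y})) = 3"
        using Z True zZ by (auto simp: tri_def card_insert_if card_ge_0_finite)
      moreover have "hit s z"
      proof -
        obtain b3 where "b3 \<in> B s" "R s y b3" using Z True by (auto simp: tri_def hit_def)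
        then show ?thesis using zy trans[OF T0[OF st(1)]] unfolding hit_def by blast
      qed
      moreover have "R s u z \<Longrightarrow> R s u y" "R s z u \<Longrightarrow> R s u y" for u
        using zy trans[OF T0[OF st(1)]] sym[OF T0[OF st(1)]] by blast+
      ultimately have "tri s (insert z (Z - {y}))"
        using Z True unfolding tri_def by blast
      moreover have "insert z (Z - {y}) \<subseteq> Y - {y}" using Z Zt z \<open>z \<noteq> y\<close> by blast
      ultimately show ?thesis by blast
    qed
  qed
  moreover have "k = card (T - {t})" "finite (T - {t})" "T - {t} \<subseteq> T0" "finite (Y - {y})"
    using Suc.hyps(2) Suc.prems t by auto
  ultimately have "card (T - {t}) \<le> card (Y - {y})"
    using Suc.hyps(1)[of "T - {t}" "Y - {y}"] unfolding tri_def hit_def by blast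
  moreover have "card Y > 0" using y Suc.prems(3) by (auto simp: card_gt_0_iff)
  ultimately show ?case
    using t y Suc.prems(1,3) by (simp add: card_Diff_singleton)
qed simp

section \<open>At most two infinite clusters\<close>

definition three_ends :: "(int ^ 'd) set set \<Rightarrow> (int ^ 'd) set \<Rightarrow> bool" where
  "three_ends S X \<longleftrightarrow> (\<exists>x y z. x \<in> X \<and> y \<in> X \<and> z \<in> X \<and>
     infinite (component S x) \<and> infinite (component S y) \<and> infinite (component S z) \<and>
     y \<notin> component S x \<and> z \<notin> component S x \<and> z \<notin> component S y)"

lemma pred_three_ends [measurable (raw)]:
  fixes X :: "(int ^ 'd::finite) set"
  assumes [measurable]: "\<And>e. Measurable.pred M (\<lambda>w. Q w e)"
  shows "Measurable.pred M (\<lambda>w. three_ends {e. Q w e} X)"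
  unfolding three_ends_def by measurable

text \<open>Each of the three infinite components keeps an infinite piece that starts in
  \<open>B\<close>, and deleting edges joins nothing.\<close>

lemma three_ends_remove:
  assumes "three_ends S B" "F \<subseteq> Pow B" "finite B"
  shows "three_ends (S - F) B"
proof -
  obtain x y z where *: "x \<in> B" "y \<in> B" "z \<in> B"
    "infinite (component S x)" "infinite (component S y)" "infinite (component S z)"
    "y \<notin> component S x" "z \<notin> component S x" "z \<notin> component S y"
    using assms(1) unfolding three_ends_def by blast
  have sub: "component (S - F) u \<subseteq> component S u" for u by (rule component_mono) blast
  obtain x' where x': "x' \<in> B" "x' \<in> component S x" "infinite (component (S - F) x')"
    using infinite_component_last_visit[OF *(4) assms(2,3) *(1)] .
  obtain y' where y': "y' \<in> B" "y' \<in> component S y" "infinite (component (S - F) y')"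
    using infinite_component_last_visit[OF *(5) assms(2,3) *(2)] .
  obtain z' where z': "z' \<in> B" "z' \<in> component S z" "infinite (component (S - F) z')"
    using infinite_component_last_visit[OF *(6) assms(2,3) *(3)] .
  have sep: "b \<notin> component (S - F) a" if "a \<in> component S u" "b \<in> component S v" "v \<notin> component S u"
    for a b u v
    using that sub[of a] by (meson component_sym component_trans subsetD)
  show ?thesis
    unfolding three_ends_def using x' y' z' sep[of _ _ _] *(7-9) by blast
qed

text \<open>Points of a sublattice of mesh \<open>m\<close>; with mesh \<open>2 * r + 1\<close> the
  balls of radius \<open>r\<close> around them are disjoint.\<close>

definition stretch :: "nat \<Rightarrow> int ^ 'd \<Rightarrow> int ^ 'd" where
  "stretch m k = (\<chi> i. int m * k $ i)"

lemma l1_stretch: "l1 (stretch m k - stretch m k') = m * l1 (k - k')"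
proof -
  have "int (l1 (stretch m k - stretch m k')) = int m * int (l1 (k - k'))"
    unfolding int_l1 by (simp add: stretch_def sum_distrib_left abs_mult right_diff_distrib[symmetric])
  then show ?thesis by (metis of_nat_eq_iff of_nat_mult)
qed

text \<open>Every infinite branch of such a ball leaves the cube and hits the shell
  \<open>cube (Suc L) - cube L\<close>, which supplies three separated points per ball. Disjointness
  and openness of the balls give the remaining hypotheses of the abstract count.\<close>

lemma trifurcation_balls_le_boundary:
  fixes S :: "(int ^ 'd::finite) set set"
  assumes "finite T" "T \<subseteq> stretch (2 * n + 1) ` cube j"
    and three: "\<And>v. v \<in> T \<Longrightarrow> three_ends (S - sball_edges v n) (sball v n)"
    and opn: "\<And>v. v \<in> T \<Longrightarrow> sball_edges v n \<subseteq> S"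
    and L: "L = (2 * n + 1) * j + 2 * n"
  shows "card T \<le> card (cube (Suc L) - cube L :: (int ^ 'd) set)"
proof -
  define F where "F v = sball_edges v n" for v :: "int ^ 'd"
  have disj: "sball s n \<inter> sball t n = {}" if "s \<in> T" "t \<in> T" "s \<noteq> t" for s t
  proof (rule ccontr)
    assume "sball s n \<inter> sball t n \<noteq> {}"
    then obtain v where "l1 (v - s) \<le> n" "l1 (v - t) \<le> n" by (auto simp: mem_sball)
    then have "l1 (s - t) \<le> 2 * n"
      using l1_triangle[of "s - v" "v - t"] by (simp add: l1_minus[of v s])
    moreover obtain k k' where "s = stretch (2 * n + 1) k" "t = stretch (2 * n + 1) k'"
      using assms(2) \<open>s \<in> T\<close> \<open>t \<in> T\<close> by blast
    ultimately have "(2 * n + 1) * l1 (k - k') \<le> 2 * n" and "k \<noteq> k'"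
      using \<open>s \<noteq> t\<close> by (metis l1_stretch, blast)
    from this(1) have "(2 * n + 1) * l1 (k - k') < (2 * n + 1) * 1" by (rule le_less_trans) simp
    then have "l1 (k - k') < 1" by (rule mult_left_less_imp_less) simp
    with \<open>k \<noteq> k'\<close> show False by simp
  qed
  have inner: "sball v n \<subseteq> cube L" if "v \<in> T" for v
  proof
    fix u assume "u \<in> sball v n"
    then have "int (l1 (u - v)) \<le> int n" by (simp add: mem_sball)
    moreover have "\<bar>(u - v) $ i\<bar> \<le> int (l1 (u - v))" for i
      unfolding int_l1 by (rule member_le_sum) auto
    moreover obtain k where k: "v = stretch (2 * n + 1) k" "k \<in> cube j"
      using assms(2) \<open>v \<in> T\<close> by blast
    then have "\<bar>v $ i\<bar> \<le> int ((2 * n + 1) * j)" for i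
      by (auto simp: stretch_def cube_def abs_mult mult_left_mono simp del: mult_Suc of_nat_Suc)
    ultimately have "\<bar>u $ i - v $ i\<bar> \<le> int n \<and> \<bar>v $ i\<bar> \<le> int ((2 * n + 1) * j)" for i
      by (metis order_trans vector_minus_component)
    moreover have "\<bar>a\<bar> \<le> x + y" if "\<bar>a - b\<bar> \<le> x \<and> \<bar>b\<bar> \<le> y" for a b x y :: int
      using that by linarith
    ultimately have "\<bar>u $ i\<bar> \<le> int n + int ((2 * n + 1) * j)" for i
      by blast
    moreover have "int n + int ((2 * n + 1) * j) \<le> int L" by (simp add: L)
    ultimately show "u \<in> cube L"
      unfolding cube_def mem_Collect_eq using order_trans by blast
  qed
  show ?thesis
  proof (rule card_trifurcations_le[where ?T0.0 = T and T = T
        and R = "\<lambda>t x y. y \<in> component (S - F t) x" and B = "\<lambda>t. sball t n"])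
    show "\<And>t x y. y \<in> component (S - F t) x \<Longrightarrow> x \<in> component (S - F t) y" by (rule component_sym)
    show "\<And>t x y z. y \<in> component (S - F t) x \<Longrightarrow> z \<in> component (S - F t) y \<Longrightarrow> z \<in> component (S - F t) x"
      by (rule component_trans)
    show "\<And>t. sball t n \<noteq> {}" using center_sball by blast
    show "b' \<in> component (S - F t) b"
      if "t \<in> T" "s \<in> T" "t \<noteq> s" "b \<in> sball s n" "b' \<in> sball s n" for t s b b'
    proof (rule sball_connected2[OF that(4,5)])
      have "e \<noteq> {}" if "e \<in> sball_edges s n" for e
        using that by (auto simp: sball_edges_eq lattice_edges_def)
      then show "sball_edges s n \<subseteq> S - F t"
        using opn[OF that(2)] disj[OF that(1-3)] unfolding F_def sball_edges_eq by blast
    qed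
    show "y \<in> component (S - F s) x"
      if "t \<in> T" "s \<in> T" "t \<noteq> s" "y \<in> component (S - F t) x" "\<forall>b\<in>sball s n. b \<notin> component (S - F t) x"
      for t s x y
    proof -
      have "y \<in> component (S - F t - F s) x"
        using component_avoid[OF that(4,5)] sball_edges_Pow unfolding F_def by blast
      then show ?thesis using component_mono[of "S - F t - F s" "S - F s" x] by blast
    qed
    show "\<exists>Z\<subseteq>cube (Suc L) - cube L. card Z = 3 \<and> (\<forall>z\<in>Z. \<exists>b\<in>sball t n. b \<in> component (S - F t) z) \<and>
        (\<forall>z\<in>Z. \<forall>z'\<in>Z. z' \<in> component (S - F t) z \<longrightarrow> z = z')" if t: "t \<in> T" for t
    proof -
      let ?C = "component (S - F t)"
      have ex: "\<exists>v. v \<in> ?C u \<and> v \<in> cube (Suc L) - cube L"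
        if u: "u \<in> sball t n" "infinite (?C u)" for u
      proof -
        obtain y where y: "y \<in> ?C u" "y \<notin> cube L"
          using u(2) finite_subset[of "?C u" "cube L"] by auto
        have "u \<in> cube L" using inner[OF t] u(1) by blast
        from component_exit[OF y(1) this y(2)] obtain a b where
          ab: "a \<in> ?C u" "a \<in> cube L" "b \<notin> cube L" "lattice_adj a b" "{a, b} \<in> S - F t" .
        have "b \<in> ?C u" using ab(1,4,5) by (rule component_step)
        moreover have "b \<in> cube (Suc L)" using ab(2,4) by (rule cube_neighbour)
        ultimately show ?thesis using ab(3) by blast
      qed
      obtain x y z where *: "x \<in> sball t n" "y \<in> sball t n" "z \<in> sball t n"
        "infinite (?C x)" "infinite (?C y)" "infinite (?C z)"
        "y \<notin> ?C x" "z \<notin> ?C x" "z \<notin> ?C y"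
        using three[OF t] unfolding three_ends_def F_def by blast
      obtain x' where x': "x' \<in> ?C x" "x' \<in> cube (Suc L) - cube L" using ex[OF *(1,4)] by blast
      obtain y' where y': "y' \<in> ?C y" "y' \<in> cube (Suc L) - cube L" using ex[OF *(2,5)] by blast
      obtain z' where z': "z' \<in> ?C z" "z' \<in> cube (Suc L) - cube L" using ex[OF *(3,6)] by blast
      have sep: "b \<notin> ?C a \<and> a \<notin> ?C b" if "a \<in> ?C u" "b \<in> ?C v" "v \<notin> ?C u" for a b u v
        using that by (meson component_sym component_trans)
      have sep': "y' \<notin> ?C x'" "x' \<notin> ?C y'" "z' \<notin> ?C x'" "x' \<notin> ?C z'" "z' \<notin> ?C y'" "y' \<notin> ?C z'"
        using sep[OF x'(1) y'(1) *(7)] sep[OF x'(1) z'(1) *(8)] sep[OF y'(1) z'(1) *(9)] by auto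
      then have "x' \<noteq> y'" "x' \<noteq> z'" "y' \<noteq> z'" using component_refl by metis+
      then have "card {x', y', z'} = 3" by simp
      moreover have "\<forall>v\<in>{x', y', z'}. \<exists>b\<in>sball t n. b \<in> ?C v"
        using *(1-3) x'(1) y'(1) z'(1) component_sym by blast
      ultimately show ?thesis
        using x'(2) y'(2) z'(2) sep' by (intro exI[of _ "{x', y', z'}"]) auto
    qed
  qed (use assms in auto)
qed

text \<open>Volume beats surface. For the side length \<open>N = 2 (a j + a) + 1\<close>,
  Bernoulli's inequality bounds the shell by \<open>2 d N ^ d / N\<close>, and
  \<open>N \<le> 3 a (2 j + 1)\<close> turns this into a bound on \<open>c * N\<close> that is
  uniform in \<open>j\<close>.\<close>

lemma boundary_ratio:
  fixes c :: real
  assumes "0 < c" and "\<And>j. c * (2 * real j + 1) ^ d \<le> (2 * real (a * j + a) + 1) ^ d - (2 * real (a * j + a) - 1) ^ d"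
    and "a \<ge> 1"
  shows False
proof -
  define N where "N j = 2 * real (a * j + a) + 1" for j
  have N: "real j \<le> N j" "N j \<ge> 2" "N j \<le> 3 * real a * (2 * real j + 1)" for j
  proof -
    have "real j \<le> real a * real j" "real a * real j \<ge> 0" "real a \<ge> 1"
      using \<open>a \<ge> 1\<close> by (auto simp: mult_right_le_one_le mult_le_cancel_right1)
    then show "real j \<le> N j" "N j \<ge> 2" "N j \<le> 3 * real a * (2 * real j + 1)"
      unfolding N_def by (auto simp: algebra_simps)
  qed
  have "c * N j \<le> 2 * real d * (3 * real a) ^ d" for j
  proof -
    have "1 - real d * (2 / N j) \<le> (1 - 2 / N j) ^ d"
      using Bernoulli_inequality[of "- (2 / N j)" d] N(2)[of j] by (simp add: field_simps)
    then have "N j ^ d * (1 - real d * (2 / N j)) \<le> N j ^ d * (1 - 2 / N j) ^ d"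
      using N(2)[of j] by (intro mult_left_mono) auto
    also have "\<dots> = (N j - 2) ^ d"
      using N(2)[of j] by (simp add: power_mult_distrib[symmetric] field_simps)
    finally have "N j ^ d - (N j - 2) ^ d \<le> N j ^ d * (real d * (2 / N j))"
      by (simp add: algebra_simps)
    then have "c * (2 * real j + 1) ^ d \<le> N j ^ d * (real d * (2 / N j))"
      using assms(2)[of j] by (simp add: N_def)
    also have "\<dots> \<le> (3 * real a * (2 * real j + 1)) ^ d * (real d * (2 / N j))"
      using N[of j] by (intro mult_right_mono power_mono) auto
    also have "\<dots> = (2 * real j + 1) ^ d * ((3 * real a) ^ d * (real d * (2 / N j)))"
      by (simp add: power_mult_distrib)
    finally have "(2 * real j + 1) ^ d * c \<le> (2 * real j + 1) ^ d * ((3 * real a) ^ d * (real d * (2 / N j)))"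
      by (simp add: mult.commute)
    then have "c \<le> (3 * real a) ^ d * (real d * (2 / N j))"
      by (rule mult_left_le_imp_le) simp
    then show ?thesis
      using N(2)[of j] by (simp add: field_simps)
  qed
  then have "c * real j \<le> 2 * real d * (3 * real a) ^ d" for j
    using N(1)[of j] \<open>0 < c\<close> by (meson mult_le_cancel_left_pos order_trans)
  moreover obtain j where "2 * real d * (3 * real a) ^ d / c < real j"
    using reals_Archimedean2 by blast
  then have "2 * real d * (3 * real a) ^ d < c * real j"
    using \<open>0 < c\<close> by (simp add: field_simps)
  ultimately show False by (meson not_le)
qed

lemma three_ends_shift:
  assumes "\<And>x. component S (x + a) = (\<lambda>v. v + a) ` component S' x"
  shows "three_ends S ((\<lambda>v. v + a) ` X) \<longleftrightarrow> three_ends S' X"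
proof -
  have inf: "infinite (component S (x + a)) \<longleftrightarrow> infinite (component S' x)" for x
    unfolding assms by (simp add: finite_image_iff)
  have mem: "y + a \<in> component S (x + a) \<longleftrightarrow> y \<in> component S' x" for x y
    unfolding assms by auto
  have "three_ends S ((\<lambda>v. v + a) ` X) \<longleftrightarrow> (\<exists>x\<in>X. \<exists>y\<in>X. \<exists>z\<in>X.
      infinite (component S (x + a)) \<and> infinite (component S (y + a)) \<and> infinite (component S (z + a)) \<and>
      y + a \<notin> component S (x + a) \<and> z + a \<notin> component S (x + a) \<and> z + a \<notin> component S (y + a))"
    unfolding three_ends_def by blast
  then show ?thesis unfolding inf mem three_ends_def by blast
qed

lemma component_shift_off:
  fixes v :: "int ^ 'd::finite"
  shows "component {e. w e < p \<and> e \<notin> sball_edges v n} (x + v)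
    = (\<lambda>u. u + v) ` component {e. shift v w e < p \<and> e \<notin> ball_edges n} x"
proof (rule component_shift_weights[where Q = "\<lambda>w e. w e < p \<and> e \<notin> ball_edges n"
      and Q' = "\<lambda>w e. w e < p \<and> e \<notin> sball_edges v n"])
  fix e :: "(int ^ 'd) set" assume "e \<in> lattice_edges"
  moreover have "inj ((`) (\<lambda>u. u + v))"
    by (simp add: inj_image_eq_iff inj_def)
  then have "(\<lambda>u. u + v) ` e \<in> sball_edges v n \<longleftrightarrow> e \<in> ball_edges n"
    unfolding sball_edges_def by (rule inj_image_mem_iff)
  ultimately show "shift v w e < p \<and> e \<notin> ball_edges n \<longleftrightarrow>
      w ((\<lambda>u. u + v) ` e) < p \<and> (\<lambda>u. u + v) ` e \<notin> sball_edges v n"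
    by (simp add: shift_def)
qed

lemma component_shift_open:
  fixes v :: "int ^ 'd::finite"
  shows "component {e. w e < p} (x + v) = (\<lambda>u. u + v) ` component {e. shift v w e < p} x"
  by (rule component_shift_weights[where Q = "\<lambda>w e. w e < p" and Q' = "\<lambda>w e. w e < p"])
     (simp add: shift_def)

text \<open>First-moment bound: the sum is the expected number of events that occur. It serves the
  trifurcation count and the exclusive events at distant points.\<close>

lemma sum_prob_le:
  assumes "finite V" "\<And>v. v \<in> V \<Longrightarrow> Measurable.pred weight_space (Q v)"
    and "AE w in weight_space. card {v \<in> V. Q v w} \<le> m"
  shows "(\<Sum>v\<in>V. \<P>(w in (weight_space :: ((int ^ 'd::finite) set \<Rightarrow> real) measure). Q v w)) \<le> real m"
proof -
  let ?M = "weight_space :: ((int ^ 'd) set \<Rightarrow> real) measure"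
  define A where "A v = {w \<in> space ?M. Q v w}" for v
  have A: "A v \<in> sets ?M" if "v \<in> V" for v
    using assms(2)[OF that] unfolding A_def by measurable
  have "(\<Sum>v\<in>V. W.prob (A v)) = W.expectation (\<lambda>w. \<Sum>v\<in>V. indicat_real (A v) w)"
    using A by (subst Bochner_Integration.integral_sum) (auto simp: W.emeasure_eq_measure)
  also have "\<dots> \<le> (\<integral>w. real m \<partial>?M)"
  proof (rule integral_mono_AE)
    show "integrable ?M (\<lambda>w. \<Sum>v\<in>V. indicat_real (A v) w)"
      using A by (auto simp: W.emeasure_eq_measure)
    show "AE w in ?M. (\<Sum>v\<in>V. indicat_real (A v) w) \<le> real m"
      using assms(3) AE_space
    proof eventually_elim
      case (elim w)
      then have "(\<Sum>v\<in>V. indicat_real (A v) w) = real (card {v \<in> V. Q v w})"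
        using assms(1) by (simp add: indicator_def A_def Int_def)
      with elim show ?case by simp
    qed
  qed simp
  finally show ?thesis by (simp add: A_def W.prob_space)
qed

text \<open>The Burton-Keane count. Having three infinite branches after deletion of the ball edges
  is independent of these edges. Opening them makes the ball a trifurcation at a fixed price, so
  trifurcations would have positive density, while a shell of lower order bounds their
  number.\<close>

lemma prob_three_ends_ball:
  fixes p :: real
  assumes "0 < p" "p \<le> 1"
  shows "\<P>(w in weight_space. three_ends {e. w e < p \<and> e \<notin> ball_edges n} (lattice_ball n :: (int ^ 'd::finite) set)) = 0"
proof (rule ccontr)
  define D where "D v w \<longleftrightarrow> three_ends {e. w e < p \<and> e \<notin> sball_edges v n} (sball v n)"
    for v :: "int ^ 'd" and w
  define E where "E v w \<longleftrightarrow> D v w \<and> (\<forall>e\<in>sball_edges v n. w e < p)" for v w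
  define q where "q = \<P>(w in weight_space. D 0 w)"
  assume "\<not> ?thesis"
  then have "q > 0" by (simp add: q_def D_def zero_less_measure_iff)
  have [measurable]: "Measurable.pred weight_space (D v)" for v
    unfolding D_def by measurable
  have [measurable]: "Measurable.pred weight_space (E v)" for v
    unfolding E_def by measurable
  have "D v w \<longleftrightarrow> D 0 (shift v w)" for v w
    unfolding D_def sball_def[of v] using three_ends_shift[OF component_shift_off] by simp
  then have q: "\<P>(w in weight_space. D v w) = q" for v
    unfolding q_def using prob_shift[of "D 0" v] by simp
  define c where "c = p ^ card (ball_edges n :: (int ^ 'd) set set) * q"
  have "c > 0" using \<open>q > 0\<close> assms by (simp add: c_def)
  have ign: "ignores {w \<in> space weight_space. D v w} (sball_edges v n)" for v
  proof (rule ignoresI)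
    fix w w' :: "(int ^ 'd) set \<Rightarrow> real"
    assume "\<forall>e\<in>lattice_edges - sball_edges v n. w e = w' e" "D v w"
    moreover from this have "component {e. w e < p \<and> e \<notin> sball_edges v n} x
        = component {e. w' e < p \<and> e \<notin> sball_edges v n} x" for x
      by (intro component_cong) auto
    ultimately show "D v w'" by (simp add: D_def three_ends_def)
  qed
  have E: "c \<le> \<P>(w in weight_space. E v w)" for v
    unfolding c_def q[of v, symmetric] card_sball_edges[of v, symmetric]
    by (rule prob_open_ignores[OF _ ign]) (use assms sball_edges_lattice in \<open>auto simp: E_def\<close>)
  define a where "a = 2 * n + 1"
  have "c * (2 * real j + 1) ^ CARD('d)
      \<le> (2 * real (a * j + a) + 1) ^ CARD('d) - (2 * real (a * j + a) - 1) ^ CARD('d)" for j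
  proof -
    define V where "V = stretch a ` (cube j :: (int ^ 'd) set)"
    \<comment> \<open>Radius \<open>n\<close> would fit with \<open>a * j + n\<close> already;
      adding \<open>2 * n\<close> gives \<open>Suc L = a * j + a\<close>, the form that
      \<open>boundary_ratio\<close> expects.\<close>
    define L where "L = a * j + 2 * n"
    have "inj_on (stretch a) (cube j :: (int ^ 'd) set)"
      by (auto simp: inj_on_def stretch_def vec_eq_iff a_def)
    then have "card V = (2 * j + 1) ^ CARD('d)"
      by (simp add: V_def card_image card_cube)
    then have "c * (2 * real j + 1) ^ CARD('d) = (\<Sum>v\<in>V. c)"
      by (simp add: add.commute)
    also have "\<dots> \<le> (\<Sum>v\<in>V. \<P>(w in weight_space. E v w))"
      by (intro sum_mono E)
    also have "\<dots> \<le> real (card (cube (Suc L) - cube L :: (int ^ 'd) set))"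
    proof (rule sum_prob_le; (intro AE_I2)?)
      fix w :: "(int ^ 'd) set \<Rightarrow> real"
      have "{e. w e < p} - sball_edges v n = {e. w e < p \<and> e \<notin> sball_edges v n}" for v by auto
      then show "card {v \<in> V. E v w} \<le> card (cube (Suc L) - cube L :: (int ^ 'd) set)"
        by (intro trifurcation_balls_le_boundary[where S = "{e. w e < p}"])
           (auto simp: V_def E_def D_def L_def a_def)
    qed (auto simp: V_def)
    also have "card (cube (Suc L) - cube L :: (int ^ 'd) set)
        = (2 * Suc L + 1) ^ CARD('d) - (2 * L + 1) ^ CARD('d)"
      using cube_mono[of L "Suc L", where 'a = 'd] by (subst card_Diff_subset) (auto simp: card_cube)
    also have "real \<dots> = (2 * real (Suc L) + 1) ^ CARD('d) - (2 * real L + 1) ^ CARD('d)"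
      by (subst of_nat_diff) (auto intro!: power_mono simp: add.commute)
    also have "\<dots> = (2 * real (a * j + a) + 1) ^ CARD('d) - (2 * real (a * j + a) - 1) ^ CARD('d)"
      by (simp add: L_def a_def algebra_simps)
    finally show ?thesis .
  qed
  then show False
    by (rule boundary_ratio[OF \<open>c > 0\<close>]) (simp add: a_def)
qed

text \<open>Three infinite clusters would all meet some large ball, and deleting its edges would
  leave three infinite pieces there; only countably many balls have to be excluded.\<close>

lemma AE_not_three_ends:
  fixes p :: real
  assumes "0 < p" "p \<le> 1"
  shows "AE w in weight_space :: ((int ^ 'd::finite) set \<Rightarrow> real) measure. \<not> three_ends {e. w e < p} UNIV"
proof -
  have "AE w in weight_space :: ((int ^ 'd) set \<Rightarrow> real) measure.
      \<forall>n. \<not> three_ends {e. w e < p \<and> e \<notin> ball_edges n} (lattice_ball n)"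
    unfolding AE_all_countable
  proof
    fix n
    show "AE w in weight_space :: ((int ^ 'd) set \<Rightarrow> real) measure.
        \<not> three_ends {e. w e < p \<and> e \<notin> ball_edges n} (lattice_ball n)"
      using prob_three_ends_ball[OF assms, of n] by (subst weight_prob_eq_0[symmetric]) auto
  qed
  then show ?thesis
  proof (rule AE_mp, intro AE_I2 impI notI)
    fix w :: "(int ^ 'd) set \<Rightarrow> real"
    assume *: "\<forall>n. \<not> three_ends {e. w e < p \<and> e \<notin> ball_edges n} (lattice_ball n)"
      and "three_ends {e. w e < p} UNIV"
    then obtain x y z where "infinite (component {e. w e < p} x)" "infinite (component {e. w e < p} y)"
      "infinite (component {e. w e < p} z)" "y \<notin> component {e. w e < p} x"
      "z \<notin> component {e. w e < p} x" "z \<notin> component {e. w e < p} y"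
      unfolding three_ends_def by blast
    moreover define n where "n = max (l1 x) (max (l1 y) (l1 z))"
    have "x \<in> lattice_ball n" "y \<in> lattice_ball n" "z \<in> lattice_ball n"
      by (auto simp: lattice_ball_l1 n_def)
    ultimately have "three_ends {e. w e < p} (lattice_ball n)"
      unfolding three_ends_def by blast
    then have "three_ends ({e. w e < p} - ball_edges n) (lattice_ball n)"
      by (rule three_ends_remove) (auto simp: ball_edges_def)
    moreover have "{e. w e < p} - ball_edges n = {e. w e < p \<and> e \<notin> ball_edges n}" by auto
    ultimately show False using * by simp
  qed
qed

subsection \<open>Connection probabilities are bounded below\<close>

lemma percolation_prob_eq:
  "percolation_prob TYPE('d::finite) p
    = \<P>(w in weight_space. infinite (component {e. w e < p} (0 :: int ^ 'd)))"
  by (simp add: percolation_prob_def cluster_eq_component)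

lemma connection_lower_bound:
  fixes p :: real
  assumes p: "0 < p" "p \<le> 1" and perc: "percolation_prob TYPE('d::finite) p > 0"
  obtains c where "c > 0" "\<And>x :: int ^ 'd. c \<le> \<P>(w in weight_space. x \<in> component {e. w e < p} 0)"
proof -
  let ?M = "weight_space :: ((int ^ 'd) set \<Rightarrow> real) measure"
  let ?C = "\<lambda>w x. component {e. w e < p} (x :: int ^ 'd)"
  \<comment> \<open>A single ball meets all infinite clusters. As there are at most two, it is
    enough that the ball contains \<open>0\<close>, when its cluster is infinite, and one point
    \<open>u\<close> of the other.\<close>
  define A where "A n w \<longleftrightarrow> (\<exists>z. infinite (?C w z)) \<and>
      (\<forall>z. infinite (?C w z) \<longrightarrow> (\<exists>b\<in>lattice_ball n. b \<in> ?C w z))" for n w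
  have [measurable]: "Measurable.pred weight_space (A n)" for n
    unfolding A_def by measurable
  have "AE w in ?M. infinite (?C w 0) \<longrightarrow> (\<exists>n. A n w)"
    using AE_not_three_ends[OF p]
  proof (rule AE_mp, intro AE_I2 impI)
    fix w :: "(int ^ 'd) set \<Rightarrow> real"
    assume three: "\<not> three_ends {e. w e < p} UNIV" and inf: "infinite (?C w 0)"
    show "\<exists>n. A n w"
    proof (cases "\<forall>z. infinite (?C w z) \<longrightarrow> 0 \<in> ?C w z")
      case True
      have "0 \<in> lattice_ball n" for n by (simp add: lattice_ball_l1)
      with True inf show ?thesis unfolding A_def by blast
    next
      case False
      then obtain u where u: "infinite (?C w u)" "0 \<notin> ?C w u" by blast
      have "0 \<in> lattice_ball (l1 u)" "u \<in> lattice_ball (l1 u)" by (auto simp: lattice_ball_l1)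
      moreover have "0 \<in> ?C w z \<or> u \<in> ?C w z" if "infinite (?C w z)" for z
        using three that inf u unfolding three_ends_def by (metis UNIV_I component_sym)
      ultimately show ?thesis using inf unfolding A_def by (intro exI[of _ "l1 u"]) blast
    qed
  qed
  then have "percolation_prob TYPE('d) p \<le> \<P>(w in ?M. \<exists>n. A n w)"
    unfolding percolation_prob_eq by (intro W.finite_measure_mono_AE) auto
  with perc have "\<not> (AE w in ?M. \<forall>n. \<not> A n w)"
    using weight_prob_eq_0[of "\<lambda>w. \<exists>n. A n w"] by auto
  then obtain n where "\<not> (AE w in ?M. \<not> A n w)"
    unfolding AE_all_countable by blast
  then have q0: "\<P>(w in ?M. A n w) > 0"
    using weight_prob_eq_0[of "A n"] by (auto simp: zero_less_measure_iff)
  define q where "q = \<P>(w in ?M. A n w)"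
  \<comment> \<open>Being an implication, \<open>J m 0\<close> holds at every configuration for
    large \<open>m\<close>, so \<open>m\<close> can be chosen to lose at most \<open>q / 2\<close>;
    by translation invariance the same \<open>m\<close> serves every \<open>x\<close>.\<close>
  define J where "J m x w \<longleftrightarrow> ((\<exists>z. infinite (?C w z)) \<longrightarrow> (\<exists>b\<in>sball x m. infinite (?C w b)))"
    for m x w
  have [measurable]: "Measurable.pred weight_space (J m x)" for m x
    unfolding J_def by measurable
  have "\<exists>m. J m 0 w" for w
  proof (cases "\<exists>z. infinite (?C w z)")
    case True
    then obtain z where "infinite (?C w z)" ..
    then have "J (l1 z) 0 w" by (auto simp: J_def lattice_ball_l1)
    then show ?thesis ..
  qed (auto simp: J_def)
  then have "1 - q / 2 < \<P>(w in ?M. \<exists>m. J m 0 w)"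
    using q0 by (simp add: q_def W.prob_space)
  moreover have "J k 0 w" if "j \<le> k" "J j 0 w" for j k w
    using that sball_mono[of j k 0] unfolding J_def by blast
  ultimately have "\<forall>\<^sub>F m in sequentially. 1 - q / 2 < \<P>(w in ?M. J m 0 w)"
    by (intro prob_incseq_eventually) auto
  then obtain m where m: "1 - q / 2 < \<P>(w in ?M. J m 0 w)"
    by (auto simp: eventually_sequentially)
  define N where "N = card (ball_edges n :: (int ^ 'd) set set) + card (ball_edges m :: (int ^ 'd) set set)"
  show ?thesis
  proof
    show "p ^ N * (q / 2) > 0" using p q0 by (simp add: q_def)
    fix x :: "int ^ 'd"
    define F where "F = ball_edges n \<union> sball_edges x m"
    \<comment> \<open>Counting \<open>F\<close> as open makes \<open>D\<close> independent of the
      weights on \<open>F\<close>, as is required for opening \<open>F\<close> afterwards.\<close>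
    define D where "D w \<longleftrightarrow> x \<in> component {e. w e < p \<or> e \<in> F} 0" for w :: "(int ^ 'd) set \<Rightarrow> real"
    have [measurable]: "Measurable.pred weight_space D" unfolding D_def by measurable
    have F: "finite F" "F \<subseteq> lattice_edges" "card F \<le> N"
      using ball_edges_lattice[of n] sball_edges_lattice[of x m] card_Un_le[of "ball_edges n" "sball_edges x m"]
      by (auto simp: F_def N_def card_sball_edges)
    have "J m x w \<longleftrightarrow> J m 0 (shift x w)" for w
    proof -
      have inf: "infinite (?C w (v + x)) \<longleftrightarrow> infinite (?C (shift x w) v)" for v
        unfolding component_shift_open by (simp add: finite_image_iff)
      have "(\<exists>z. infinite (?C w z)) \<longleftrightarrow> (\<exists>z. infinite (?C w (z + x)))"
        by (metis diff_add_cancel)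
      moreover have "(\<exists>b\<in>sball x m. infinite (?C w b)) \<longleftrightarrow> (\<exists>b\<in>sball 0 m. infinite (?C w (b + x)))"
        by (auto simp: sball_def)
      ultimately show ?thesis unfolding J_def inf by simp
    qed
    then have "\<P>(w in ?M. J m x w) = \<P>(w in ?M. J m 0 w)"
      using prob_shift[of "J m 0" x] by simp
    with m have "q / 2 \<le> \<P>(w in ?M. A n w) + \<P>(w in ?M. J m x w) - 1"
      by (simp add: q_def)
    also have "\<dots> \<le> W.prob ({w \<in> space ?M. A n w} \<inter> {w \<in> space ?M. J m x w})"
    proof -
      have "W.prob ({w \<in> space ?M. A n w} \<union> {w \<in> space ?M. J m x w}) \<le> 1" by simp
      moreover have "W.prob ({w \<in> space ?M. A n w} \<union> {w \<in> space ?M. J m x w})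
          = \<P>(w in ?M. A n w) + \<P>(w in ?M. J m x w)
            - W.prob ({w \<in> space ?M. A n w} \<inter> {w \<in> space ?M. J m x w})"
        by (rule measure_Un3) (auto simp: fmeasurable_def W.emeasure_eq_measure)
      ultimately show ?thesis by linarith
    qed
    also have "\<dots> \<le> \<P>(w in ?M. D w)"
    proof (rule W.finite_measure_mono)
      show "{w \<in> space ?M. A n w} \<inter> {w \<in> space ?M. J m x w} \<subseteq> {w \<in> space ?M. D w}"
      proof clarsimp
        fix w assume "A n w" "J m x w"
        then obtain b a where b: "b \<in> sball x m" "infinite (?C w b)"
          and a: "a \<in> lattice_ball n" "a \<in> ?C w b"
          unfolding A_def J_def by blast
        let ?S = "{e. w e < p \<or> e \<in> F}"
        have "a \<in> component ?S 0"
          using ball_connected[OF a(1)] component_mono[of "ball_edges n" ?S] by (auto simp: F_def)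
        moreover have "b \<in> component ?S a"
          using component_sym[OF a(2)] component_mono[of "{e. w e < p}" ?S] by blast
        moreover have "x \<in> component ?S b"
          by (rule sball_connected2[OF b(1)]) (auto simp: F_def)
        ultimately show "D w" unfolding D_def by (meson component_trans)
      qed
    qed measurable
    finally have D: "q / 2 \<le> \<P>(w in ?M. D w)" .
    \<comment> \<open>The two balls may share edges; \<open>N\<close> bounds the size of their union
      for every \<open>x\<close>, which makes the constant uniform.\<close>
    have "p ^ N * (q / 2) \<le> p ^ card F * \<P>(w in ?M. D w)"
      using p F D q0 by (intro mult_mono power_decreasing) (auto simp: q_def)
    also have "\<dots> \<le> \<P>(w in ?M. x \<in> ?C w 0)"
    proof (rule prob_open_ignores)
      show "ignores {w \<in> space ?M. D w} F"
      proof (rule ignoresI)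
        fix w w' :: "(int ^ 'd) set \<Rightarrow> real"
        assume "\<forall>e\<in>lattice_edges - F. w e = w' e" "D w"
        moreover from this have "component {e. w e < p \<or> e \<in> F} 0 = component {e. w' e < p \<or> e \<in> F} 0"
          by (intro component_cong) auto
        ultimately show "D w'" by (simp add: D_def)
      qed
      show "w \<in> {w \<in> space ?M. x \<in> ?C w 0}"
        if "w \<in> {w \<in> space ?M. D w}" "\<forall>e\<in>F. w e < p" for w
      proof -
        have "{e. w e < p \<or> e \<in> F} = {e. w e < p}" using that by auto
        with that show ?thesis by (simp add: D_def)
      qed
    qed (use p F in auto)
    finally show "p ^ N * (q / 2) \<le> \<P>(w in ?M. x \<in> ?C w 0)" .
  qed
qed

section \<open>Passage times\<close>

lemma path_time_nonneg: "0 \<le> path_time K w \<gamma>"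
  unfolding path_time_def by (rule sum_list_nonneg) auto

lemma path_time_append:
  "path_edges \<eta> = path_edges \<gamma> @ path_edges \<delta> \<Longrightarrow> path_time K w \<eta> = path_time K w \<gamma> + path_time K w \<delta>"
  by (simp add: path_time_def)

lemma path_time_edge:
  assumes "e \<in> set (path_edges \<gamma>)"
  shows "exp (K * w e) \<le> path_time K w \<gamma>"
  unfolding path_time_def by (rule member_le_sum_list) (use assms in auto)

lemma path_time_le:
  assumes "0 \<le> K" "\<And>e. e \<in> set (path_edges \<gamma>) \<Longrightarrow> w e \<le> m"
  shows "path_time K w \<gamma> \<le> real (length (path_edges \<gamma>)) * exp (K * m)"
proof -
  have "path_time K w \<gamma> \<le> (\<Sum>e\<leftarrow>path_edges \<gamma>. exp (K * m))"
    unfolding path_time_def using assms by (intro sum_list_mono) (auto intro: mult_left_mono)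
  then show ?thesis by (simp add: sum_list_triv)
qed

lemma lattice_paths_nonempty: "lattice_paths x y \<noteq> ({} :: (int ^ 'd::finite) list set)"
  using ex_lattice_path[of x y] by blast

lemma bdd_below_path_time: "bdd_below (path_time K w ` A)"
  by (rule bdd_belowI2[where m = 0]) (rule path_time_nonneg)

lemma passage_time_le: "\<gamma> \<in> lattice_paths x y \<Longrightarrow> passage_time K w x y \<le> path_time K w \<gamma>"
  unfolding passage_time_def by (rule cINF_lower[OF bdd_below_path_time])

lemma passage_time_less_iff:
  fixes x y :: "int ^ 'd::finite"
  shows "passage_time K w x y < c \<longleftrightarrow> (\<exists>\<gamma>\<in>lattice_paths x y. path_time K w \<gamma> < c)"
  unfolding passage_time_def by (rule cINF_less_iff[OF lattice_paths_nonempty bdd_below_path_time])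

lemma boundary_time_ge:
  fixes w :: "(int ^ 'd::finite) set \<Rightarrow> real"
  assumes "\<And>\<gamma> y. \<gamma> \<in> lattice_paths 0 y \<Longrightarrow> l1 y = R \<Longrightarrow> c \<le> path_time K w \<gamma>"
  shows "c \<le> boundary_time K w R"
proof -
  have "c \<le> passage_time K w 0 y" if "y \<in> ball_boundary R" for y
    unfolding passage_time_def using assms that
    by (intro cINF_greatest lattice_paths_nonempty) (auto simp: ball_boundary_l1)
  then show ?thesis
    unfolding boundary_time_def by (subst Min_ge_iff) auto
qed

text \<open>A step increases the distance from 0 by at most one, so a path ending at distance at
  least \<open>R\<close> has visited the sphere; dropping the rest only lowers the time.\<close>

lemma boundary_time_le:
  fixes w :: "(int ^ 'd::finite) set \<Rightarrow> real"
  assumes "\<gamma> \<in> lattice_paths 0 y" "R \<le> l1 y"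
  shows "boundary_time K w R \<le> path_time K w \<gamma>"
  using assms
proof (induction rule: lattice_path_induct)
  case single
  then have "boundary_time K w R \<le> passage_time K w 0 0"
    unfolding boundary_time_def by (intro Min_le finite_imageI finite_ball_boundary) (auto simp: ball_boundary_l1)
  also have "\<dots> \<le> path_time K w [0]" by (rule passage_time_le) simp
  finally show ?case .
next
  case (extend \<gamma> y z)
  note \<gamma>z = lattice_path_extend[OF extend(1,2)]
  show ?case
  proof (cases "l1 z = R")
    case True
    then have "boundary_time K w R \<le> passage_time K w 0 z"
      unfolding boundary_time_def by (intro Min_le finite_imageI finite_ball_boundary) (auto simp: ball_boundary_l1)
    also have "\<dots> \<le> path_time K w (\<gamma> @ [z])" by (rule passage_time_le) (rule \<gamma>z(1))
    finally show ?thesis .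
  next
    case False
    with extend(4) lattice_adj_l1_le[OF extend(2)] have "R \<le> l1 y" by simp
    with extend.IH have "boundary_time K w R \<le> path_time K w \<gamma>" by simp
    also have "\<dots> \<le> path_time K w (\<gamma> @ [z])" by (simp add: path_time_def \<gamma>z(2))
    finally show ?thesis .
  qed
qed

lemma measurable_path_time [measurable]: "(\<lambda>w. path_time K w \<gamma>) \<in> borel_measurable weight_space"
proof -
  have "(\<lambda>w. \<Sum>e\<leftarrow>es. exp (K * w e)) \<in> borel_measurable weight_space" for es :: "(int ^ 'a) set list"
    by (induction es) auto
  then show ?thesis by (simp add: path_time_def)
qed

lemma measurable_passage_time [measurable]:
  fixes x y :: "int ^ 'd::finite"
  shows "(\<lambda>w. passage_time K w x y) \<in> borel_measurable weight_space"
  unfolding passage_time_def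
  by (rule borel_measurable_cINF) (auto intro: bdd_below_path_time)

lemma measurable_boundary_time [measurable]:
  "(\<lambda>w :: (int ^ 'd::finite) set \<Rightarrow> real. boundary_time K w R) \<in> borel_measurable weight_space"
  unfolding boundary_time_def by (rule borel_measurable_Min) auto

subsection \<open>The parameter K\<close>

text \<open>Since \<open>(1 - e) powr (1 / n)\<close> lies in [0, 1), \<open>delta\<close> is
  positive and at most \<open>1 / (n - 1)\<close>; \<open>2 \<le> R\<close> keeps this denominator
  positive.\<close>

lemma K_param_ge:
  fixes R :: nat and e :: real
  defines "n \<equiv> card (ball_edges R :: (int ^ 'd::finite) set set)"
  assumes "0 < e" "e \<le> 1" "2 \<le> R"
  shows "(real n - 1) * ln (real n) \<le> K_param TYPE('d) R e"
proof -
  have n: "2 \<le> n" using card_ball_edges_ge[of R, where 'd = 'd] assms by (simp add: n_def)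
  have pos: "(1 - e) powr (1 / real n) < 1"
    using powr_less_mono2[of "1 / real n" "1 - e" 1] assms n by simp
  then have \<delta>: "0 < delta TYPE('d) R e" "delta TYPE('d) R e \<le> 1 / (real n - 1)"
    using n by (auto simp: delta_def n_def[symmetric] Let_def intro!: divide_pos_pos divide_right_mono)
  have "(real n - 1) * ln (real n) = ln (real n) / (1 / (real n - 1))" by simp
  also have "\<dots> \<le> ln (real n) / delta TYPE('d) R e"
    using \<delta> n by (intro divide_left_mono) auto
  finally show ?thesis by (simp add: K_param_def n_def)
qed

lemma K_param_at_top:
  assumes "0 < e" "e \<le> 1"
  shows "filterlim (\<lambda>R. K_param TYPE('d::finite) R e) at_top sequentially"
proof (rule filterlim_at_top_mono)
  show "filterlim (\<lambda>R. (real R - 1) * ln (real R)) at_top sequentially"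
    by real_asymp
  show "\<forall>\<^sub>F R in sequentially. (real R - 1) * ln (real R) \<le> K_param TYPE('d) R e"
    using eventually_ge_at_top[of 2]
  proof eventually_elim
    case (elim R)
    let ?n = "card (ball_edges R :: (int ^ 'd) set set)"
    have "R \<le> ?n" by (rule card_ball_edges_ge)
    then have "(real R - 1) * ln (real R) \<le> (real ?n - 1) * ln (real ?n)"
      using elim by (intro mult_mono) auto
    also have "\<dots> \<le> K_param TYPE('d) R e"
      by (rule K_param_ge[OF assms elim])
    finally show ?case .
  qed
qed

text \<open>This is how large \<open>K\<close> singles out the largest weight: once
  \<open>(n - 1) * c \<ge> 1\<close>, the bound \<open>K \<ge> (n - 1) ln n\<close> gives
  \<open>K * c \<ge> ln n\<close>.\<close>

lemma K_param_gap:
  assumes "0 < e" "e \<le> 1" "0 < c"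
  shows "\<forall>\<^sub>F R in sequentially. real (card (ball_edges R :: (int ^ 'd::finite) set set))
           \<le> exp (K_param TYPE('d) R e * c)"
proof -
  obtain k where k: "1 / c \<le> real k" using real_arch_simple by blast
  show ?thesis
    using eventually_ge_at_top[of "k + 2"]
  proof eventually_elim
    case (elim R)
    let ?n = "card (ball_edges R :: (int ^ 'd) set set)"
    have n: "R \<le> ?n" by (rule card_ball_edges_ge)
    have "1 \<le> (real ?n - 1) * c"
    proof -
      have "1 = (1 / c) * c" using \<open>0 < c\<close> by simp
      also have "\<dots> \<le> (real ?n - 1) * c"
        using k n elim \<open>0 < c\<close> by (intro mult_right_mono) auto
      finally show ?thesis .
    qed
    then have "ln (real ?n) * 1 \<le> ln (real ?n) * ((real ?n - 1) * c)"
      using n elim by (intro mult_left_mono) auto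
    also have "\<dots> = ((real ?n - 1) * ln (real ?n)) * c" by simp
    also have "\<dots> \<le> K_param TYPE('d) R e * c"
      using K_param_ge[OF assms(1,2), of R, where 'd = 'd] elim \<open>0 < c\<close> by (intro mult_right_mono) auto
    finally have "exp (ln (real ?n)) \<le> exp (K_param TYPE('d) R e * c)" by simp
    then show ?case using n elim by simp
  qed
qed

subsection \<open>Percolation at criticality\<close>

text \<open>The path to \<open>x\<close> costs at most its length times \<open>exp (K * m)\<close>,
  while a path leaving the finite cluster of level \<open>q\<close> contains an edge of weight at
  least \<open>q\<close>; the ratio \<open>exp (K * (q - m))\<close> outgrows the fixed
  length.\<close>

lemma eventually_passage_less_boundary:
  fixes w :: "(int ^ 'd::finite) set \<Rightarrow> real"
  assumes K: "filterlim K at_top sequentially"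
    and \<gamma>: "\<gamma> \<in> lattice_paths 0 x" "\<And>e. e \<in> set (path_edges \<gamma>) \<Longrightarrow> w e \<le> m"
    and "m < q" "finite (component {e. w e < q} 0)"
  shows "\<forall>\<^sub>F R in sequentially. passage_time (K R) w 0 x < boundary_time (K R) w R"
proof -
  let ?l = "real (length (path_edges \<gamma>))"
  obtain R1 where R1: "component {e. w e < q} 0 \<subseteq> lattice_ball R1"
    using assms(5) infinite_iff_leaves_balls by blast
  have "filterlim (\<lambda>R. exp (K R * (q - m))) at_top sequentially"
    using \<open>m < q\<close> by (intro filterlim_compose[OF exp_at_top] filterlim_at_top_mult_tendsto_pos[OF tendsto_const _ K]) simp
  then have "\<forall>\<^sub>F R in sequentially. ?l < exp (K R * (q - m))"
    by (simp add: filterlim_at_top_dense)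
  moreover have "\<forall>\<^sub>F R in sequentially. 0 \<le> K R"
    using K by (simp add: filterlim_at_top)
  ultimately show ?thesis
    using eventually_gt_at_top[of R1]
  proof eventually_elim
    case (elim R)
    have "passage_time (K R) w 0 x \<le> path_time (K R) w \<gamma>"
      by (rule passage_time_le) (rule \<gamma>(1))
    also have "\<dots> \<le> ?l * exp (K R * m)"
      using elim by (intro path_time_le \<gamma>(2))
    also have "\<dots> < exp (K R * (q - m)) * exp (K R * m)"
      using elim by (intro mult_strict_right_mono) auto
    also have "\<dots> = exp (K R * q)" by (simp add: exp_add[symmetric] algebra_simps)
    also have "\<dots> \<le> boundary_time (K R) w R"
    proof (rule boundary_time_ge)
      fix \<delta> and y :: "int ^ 'd" assume \<delta>: "\<delta> \<in> lattice_paths 0 y" "l1 y = R"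
      then have "y \<notin> component {e. w e < q} 0"
        using R1 elim by (auto simp: lattice_ball_l1)
      then obtain e where e: "e \<in> set (path_edges \<delta>)" "q \<le> w e"
        using \<delta>(1) unfolding component_path_iff by fastforce
      have "exp (K R * q) \<le> exp (K R * w e)" using e(2) elim by (auto intro: mult_left_mono)
      also have "\<dots> \<le> path_time (K R) w \<delta>" by (rule path_time_edge) (rule e(1))
      finally show "exp (K R * q) \<le> path_time (K R) w \<delta>" .
    qed
    finally show ?case .
  qed
qed

section \<open>The percolation probability as a function of the level\<close>

lemma percolation_prob_1: "percolation_prob TYPE('d::finite) 1 = 1"
  unfolding percolation_prob_eq
proof (subst W.prob_eq_1)
  show "AE w in weight_space. w \<in> {w \<in> space weight_space. infinite (component {e. w e < 1} (0 :: int ^ 'd))}"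
    using AE_weight_less_1 AE_space
  proof eventually_elim
    case (elim w)
    have "y \<in> component {e. w e < 1} 0" for y
      using ex_lattice_path[of 0 y] elim path_edges_lattice unfolding component_path_iff by blast
    moreover have "infinite (UNIV :: (int ^ 'd) set)"
      unfolding infinite_iff_leaves_balls using l1_axis[of undefined "int (Suc n)" for n]
      by (auto simp: lattice_ball_l1 not_le) (metis l1_axis lessI nat_int abs_of_nat)
    ultimately have "infinite (component {e. w e < 1} 0)" by (metis UNIV_eq_I)
    with elim show ?case by simp
  qed
qed measurable

lemma component_no_edges:
  assumes "\<And>e. e \<in> lattice_edges \<Longrightarrow> e \<notin> S"
  shows "component S x = {x}"
proof -
  have "y = x" if "y \<in> component S x" for y
    using that by (induction rule: component_induct) (use assms in auto)
  then show ?thesis by auto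
qed

lemma percolation_prob_nonpos:
  assumes "p \<le> 0"
  shows "percolation_prob TYPE('d::finite) p = 0"
proof -
  have "AE w in weight_space. \<not> infinite (component {e. w e < p} (0 :: int ^ 'd))"
    using AE_weight_nonneg
  proof eventually_elim
    case (elim w)
    then have "component {e. w e < p} 0 = {0}"
      using assms by (intro component_no_edges) force
    then show ?case by simp
  qed
  then show ?thesis
    unfolding percolation_prob_eq by (subst weight_prob_eq_0) auto
qed

lemma percolation_prob_mono:
  assumes "p \<le> q"
  shows "percolation_prob TYPE('d::finite) p \<le> percolation_prob TYPE('d) q"
  unfolding percolation_prob_eq
proof (rule W.finite_measure_mono)
  have "component {e. w e < p} 0 \<subseteq> component {e. w e < q} (0 :: int ^ 'd)" for w
    using assms by (intro component_mono) auto
  then show "{w \<in> space weight_space. infinite (component {e. w e < p} (0 :: int ^ 'd))}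
    \<subseteq> {w \<in> space weight_space. infinite (component {e. w e < q} 0)}"
    using finite_subset by blast
qed measurable

lemma critical_prob_bounds:
  "0 \<le> critical_prob TYPE('d::finite)" "critical_prob TYPE('d) \<le> 1"
proof -
  let ?S = "{p \<in> {0..1}. percolation_prob TYPE('d) p > 0}"
  have "1 \<in> ?S" by (simp add: percolation_prob_1)
  moreover have "bdd_below ?S" by (rule bdd_belowI[of _ 0]) auto
  ultimately show "critical_prob TYPE('d) \<le> 1"
    unfolding critical_prob_def by (rule cInf_lower)
  show "0 \<le> critical_prob TYPE('d)"
    unfolding critical_prob_def using \<open>1 \<in> ?S\<close> by (intro cInf_greatest) auto
qed

lemma percolation_below_critical:
  assumes "p < critical_prob TYPE('d::finite)"
  shows "percolation_prob TYPE('d) p = 0"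
\<comment> \<open>Negative levels are not covered by an infimum over [0, 1] and are treated
  directly.\<close>
proof (cases "p \<le> 0")
  case False
  have "bdd_below {p \<in> {0..1}. percolation_prob TYPE('d) p > 0}"
    by (rule bdd_belowI[of _ 0]) auto
  then have "p \<notin> {p \<in> {0..1}. percolation_prob TYPE('d) p > 0}"
    using assms cInf_lower unfolding critical_prob_def by (meson not_le)
  moreover have "p \<le> 1" using assms critical_prob_bounds(2)[where 'd = 'd] by linarith
  ultimately have "\<not> percolation_prob TYPE('d) p > 0"
    using False by simp
  moreover have "percolation_prob TYPE('d) p \<ge> 0" by (simp add: percolation_prob_def)
  ultimately show ?thesis by linarith
qed (rule percolation_prob_nonpos)

lemma percolation_above_critical:
  assumes "critical_prob TYPE('d::finite) < p"
  shows "percolation_prob TYPE('d) p > 0"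
proof -
  have "\<exists>q\<in>{p \<in> {0..1}. percolation_prob TYPE('d) p > 0}. q < p"
    using assms unfolding critical_prob_def
    by (intro cInf_lessD) (auto simp: percolation_prob_1 intro!: exI[of _ 1])
  then show ?thesis
    using percolation_prob_mono by (metis (no_types, lifting) less_imp_le less_le_trans mem_Collect_eq)
qed

lemma eventually_prob_ge_connection:
  fixes x :: "int ^ 'd::finite"
  defines "p \<equiv> critical_prob TYPE('d)"
  assumes K: "filterlim K at_top sequentially" and "0 < p"
    and c: "0 < c" "c \<le> \<P>(w in weight_space. x \<in> component {e. w e < p} 0)"
  shows "\<forall>\<^sub>F R in sequentially.
    c / 2 \<le> \<P>(w in weight_space. passage_time (K R) w 0 x < boundary_time (K R) w R)"
proof -
  let ?M = "weight_space :: ((int ^ 'd) set \<Rightarrow> real) measure"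
  define Q where "Q R w \<longleftrightarrow> passage_time (K R) w 0 x < boundary_time (K R) w R" for R w
  have [measurable]: "Measurable.pred ?M (Q R)" for R
    unfolding Q_def by measurable
  \<comment> \<open>Rational levels leave a countable family of null sets, and a rational fits
    between the largest weight on a path and \<open>p\<close>.\<close>
  have "AE w in ?M. \<forall>q\<in>\<rat>. q < p \<longrightarrow> finite (component {e. w e < q} (0 :: int ^ 'd))"
    unfolding AE_ball_countable[OF countable_rat]
  proof
    fix q :: real
    show "AE w in ?M. q < p \<longrightarrow> finite (component {e. w e < q} (0 :: int ^ 'd))"
    proof (cases "q < p")
      case True
      then have "percolation_prob TYPE('d) q = 0"
        unfolding p_def by (rule percolation_below_critical)
      then have "AE w in ?M. \<not> infinite (component {e. w e < q} (0 :: int ^ 'd))"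
        unfolding percolation_prob_eq by (subst (asm) weight_prob_eq_0) auto
      then show ?thesis by simp
    qed simp
  qed
  then have "AE w in ?M. x \<in> component {e. w e < p} 0 \<longrightarrow> (\<exists>N. \<forall>R\<ge>N. Q R w)"
  proof (rule AE_mp, intro AE_I2 impI)
    fix w :: "(int ^ 'd) set \<Rightarrow> real"
    assume fin: "\<forall>q\<in>\<rat>. q < p \<longrightarrow> finite (component {e. w e < q} 0)"
      and "x \<in> component {e. w e < p} 0"
    then obtain \<gamma> where \<gamma>: "\<gamma> \<in> lattice_paths 0 x" "set (path_edges \<gamma>) \<subseteq> {e. w e < p}"
      unfolding component_path_iff by blast
    \<comment> \<open>Inserting 0 covers the path without edges; \<open>0 < p\<close> keeps
      \<open>m < p\<close>.\<close>
    define m where "m = Max (insert 0 (w ` set (path_edges \<gamma>)))"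
    have "m < p" unfolding m_def using \<gamma> \<open>0 < p\<close> by (subst Max_less_iff) auto
    then obtain q where q: "q \<in> \<rat>" "m < q" "q < p" using Rats_dense_in_real by blast
    have "\<forall>\<^sub>F R in sequentially. Q R w"
      unfolding Q_def
    proof (rule eventually_passage_less_boundary[OF K \<gamma>(1) _ q(2)])
      show "w e \<le> m" if "e \<in> set (path_edges \<gamma>)" for e
        unfolding m_def using that by (intro Max_ge) auto
      show "finite (component {e. w e < q} 0)" using fin q by blast
    qed
    then show "\<exists>N. \<forall>R\<ge>N. Q R w" by (simp add: eventually_sequentially)
  qed
  then have "\<P>(w in ?M. x \<in> component {e. w e < p} 0) \<le> \<P>(w in ?M. \<exists>N. \<forall>R\<ge>N. Q R w)"
    by (intro W.finite_measure_mono_AE) auto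
  then have "c / 2 < \<P>(w in ?M. \<exists>N. \<forall>R\<ge>N. Q R w)"
    using c by linarith
  \<comment> \<open>The events \<open>\<forall>R\<ge>N. Q R w\<close> increase with
    \<open>N\<close>; halving \<open>c\<close> makes the bound on their union strict.\<close>
  then have "\<forall>\<^sub>F N in sequentially. c / 2 < \<P>(w in ?M. \<forall>R\<ge>N. Q R w)"
    by (intro prob_incseq_eventually) auto
  then obtain N where N: "c / 2 < \<P>(w in ?M. \<forall>R\<ge>N. Q R w)"
    by (auto simp: eventually_sequentially)
  show ?thesis
    using eventually_ge_at_top[of N]
  proof eventually_elim
    case (elim R)
    have "\<P>(w in ?M. \<forall>R\<ge>N. Q R w) \<le> \<P>(w in ?M. Q R w)"
      using elim by (intro W.finite_measure_mono) auto
    with N show ?case by (simp add: Q_def)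
  qed
qed

section \<open>Percolation clusters and geodesics\<close>

lemma path_time_extend:
  assumes "\<gamma> \<in> lattice_paths x y" "lattice_adj y z"
  shows "path_time K w (\<gamma> @ [z]) = path_time K w \<gamma> + exp (K * w {y, z})"
  by (simp add: path_time_def lattice_path_extend[OF assms])

text \<open>Stop the path at its first vertex in \<open>A\<close>: no edge up to there has both ends
  in \<open>A\<close>. If the path ends outside \<open>A\<close>, something of positive time is
  dropped, whence the strict inequality.\<close>

lemma path_first_hit:
  assumes "\<gamma> \<in> lattice_paths x y"
  shows "(\<exists>z \<delta>. z \<in> A \<and> \<delta> \<in> lattice_paths x z \<and> (\<forall>e\<in>set (path_edges \<delta>). \<not> e \<subseteq> A) \<and>
      path_time K w \<delta> \<le> path_time K w \<gamma> \<and> (y \<notin> A \<longrightarrow> path_time K w \<delta> < path_time K w \<gamma>))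
    \<or> y \<notin> A \<and> (\<forall>e\<in>set (path_edges \<gamma>). \<not> e \<subseteq> A)"
  using assms
proof (induction rule: lattice_path_induct)
  case single
  show ?case by (cases "x \<in> A") (auto intro!: exI[of _ x] exI[of _ "[x]"])
next
  case (extend \<gamma> y z)
  note \<gamma>z = lattice_path_extend[OF extend(1,2)] path_time_extend[OF extend(1,2), of K w]
  have less: "path_time K w \<gamma> < path_time K w (\<gamma> @ [z])" by (simp add: \<gamma>z(3))
  from extend.IH show ?case
  proof
    assume "\<exists>z' \<delta>. z' \<in> A \<and> \<delta> \<in> lattice_paths x z' \<and> (\<forall>e\<in>set (path_edges \<delta>). \<not> e \<subseteq> A) \<and>
      path_time K w \<delta> \<le> path_time K w \<gamma> \<and> (y \<notin> A \<longrightarrow> path_time K w \<delta> < path_time K w \<gamma>)"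
    then obtain z' \<delta> where "z' \<in> A" "\<delta> \<in> lattice_paths x z'"
      "\<forall>e\<in>set (path_edges \<delta>). \<not> e \<subseteq> A" "path_time K w \<delta> \<le> path_time K w \<gamma>" by blast
    with less show ?thesis by (intro disjI1 exI[of _ z'] exI[of _ \<delta>]) auto
  next
    assume y: "y \<notin> A \<and> (\<forall>e\<in>set (path_edges \<gamma>). \<not> e \<subseteq> A)"
    then have "\<forall>e\<in>set (path_edges (\<gamma> @ [z])). \<not> e \<subseteq> A" by (auto simp: \<gamma>z(2))
    with \<gamma>z(1) show ?thesis by (cases "z \<in> A") blast+
  qed
qed

text \<open>Cut at the last entry into \<open>A\<close>; the rest of the path has nonnegative
  time.\<close>

lemma path_crossing:
  assumes "\<gamma> \<in> lattice_paths x y" "x \<notin> A" "y \<in> A"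
  shows "\<exists>u z \<delta>. \<delta> \<in> lattice_paths x u \<and> u \<notin> A \<and> z \<in> A \<and> lattice_adj u z \<and>
    path_time K w \<delta> + exp (K * w {u, z}) \<le> path_time K w \<gamma>"
  using assms(1,3)
proof (induction rule: lattice_path_induct)
  case single
  with assms(2) show ?case by blast
next
  case (extend \<gamma> y z)
  note \<gamma>z = path_time_extend[OF extend(1,2), of K w]
  show ?case
  proof (cases "y \<in> A")
    case True
    then obtain u z' \<delta> where "\<delta> \<in> lattice_paths x u" "u \<notin> A" "z' \<in> A" "lattice_adj u z'"
      "path_time K w \<delta> + exp (K * w {u, z'}) \<le> path_time K w \<gamma>"
      using extend.IH by blast
    moreover have "path_time K w \<gamma> \<le> path_time K w (\<gamma> @ [z])" by (simp add: \<gamma>z)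
    ultimately show ?thesis by (meson order_trans)
  next
    case False
    with extend \<gamma>z show ?thesis by (intro exI[of _ y] exI[of _ z] exI[of _ \<gamma>]) simp
  qed
qed

section \<open>Escape to the boundary along an infinite cluster\<close>

lemma relpow_links_path:
  assumes "(x, y) \<in> links S ^^ n"
  shows "\<exists>\<gamma>\<in>lattice_paths x y. set (path_edges \<gamma>) \<subseteq> S \<and> length (path_edges \<gamma>) = n"
  using assms
proof (induction n arbitrary: y)
  case 0
  then show ?case by (intro bexI[of _ "[x]"]) auto
next
  case (Suc n)
  then obtain u where "(x, u) \<in> links S ^^ n" "(u, y) \<in> links S" by auto
  moreover from this Suc.IH obtain \<gamma> where
    "\<gamma> \<in> lattice_paths x u" "set (path_edges \<gamma>) \<subseteq> S" "length (path_edges \<gamma>) = n" by blast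
  ultimately show ?case
    by (intro bexI[of _ "\<gamma> @ [y]"]) (auto simp: lattice_path_extend links_def)
qed

lemma card_links_le:
  assumes "finite S"
  shows "finite (links S)" "card (links S) \<le> 2 * card S"
proof -
  define P where "P e = {(x, y). {x, y} = e}" for e :: "(int ^ 'a) set"
  have P: "finite (P e) \<and> card (P e) \<le> 2" if "e \<in> S" for e
  proof (cases "\<exists>x y. e = {x, y}")
    case True
    then obtain x y where "e = {x, y}" by blast
    then have sub: "P e \<subseteq> {(x, y), (y, x)}" by (auto simp: P_def doubleton_eq_iff)
    have "card (P e) \<le> card {(x, y), (y, x)}" using sub by (intro card_mono) auto
    also have "\<dots> \<le> 2" by (intro card_insert_le_m1) auto
    finally show ?thesis using finite_subset[OF sub] by simp
  next
    case False
    then have "P e = {}" by (auto simp: P_def)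
    then show ?thesis by simp
  qed
  have sub: "links S \<subseteq> (\<Union>e\<in>S. P e)" by (auto simp: links_def P_def)
  have fin: "finite (\<Union>e\<in>S. P e)" using assms P by blast
  then show "finite (links S)" using sub by (rule finite_subset[rotated])
  have "card (links S) \<le> card (\<Union>e\<in>S. P e)" using fin sub by (rule card_mono)
  also have "\<dots> \<le> (\<Sum>e\<in>S. card (P e))" using assms by (rule card_UN_le)
  also have "\<dots> \<le> (\<Sum>e\<in>S. 2)" using P by (intro sum_mono) blast
  finally show "card (links S) \<le> 2 * card S" by simp
qed

text \<open>In a finite relation the closure is reached in at most as many steps as there are pairs,
  and each edge contributes two orientations. This is the origin of the factor 2 in the later
  bounds.\<close>

lemma component_short_path:
  assumes "y \<in> component S x" "finite S"
  obtains \<gamma> where "\<gamma> \<in> lattice_paths x y" "set (path_edges \<gamma>) \<subseteq> S"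
    "length (path_edges \<gamma>) \<le> 2 * card S"
proof -
  have "(x, y) \<in> (\<Union>n\<in>{n. n \<le> card (links S)}. links S ^^ n)"
    using assms(1) rtrancl_finite_eq_relpow[OF card_links_le(1)[OF assms(2)]]
    by (simp add: component_def)
  then obtain n where n: "n \<le> card (links S)" "(x, y) \<in> links S ^^ n" by blast
  obtain \<gamma> where "\<gamma> \<in> lattice_paths x y" "set (path_edges \<gamma>) \<subseteq> S" "length (path_edges \<gamma>) = n"
    using relpow_links_path[OF n(2)] by blast
  moreover have "n \<le> 2 * card S"
    using n(1) card_links_le(2)[OF assms(2)] by linarith
  ultimately show ?thesis using that by blast
qed

lemma boundary_time_via_cluster:
  fixes w :: "(int ^ 'd::finite) set \<Rightarrow> real"
  assumes "infinite (component {e. w e < p} y)" "\<pi> \<in> lattice_paths 0 y" "0 \<le> K"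
  shows "boundary_time K w R
    \<le> path_time K w \<pi> + 2 * real (card (ball_edges R :: (int ^ 'd) set set)) * exp (K * p)"
proof -
  let ?S = "{e. w e < p} \<inter> ball_edges R"
  \<comment> \<open>Otherwise every open edge at this component would lie in the ball, so the
    component would be the whole cluster of \<open>y\<close> and hence finite.\<close>
  have "\<exists>z\<in>component ?S y. R \<le> l1 z"
  proof (rule ccontr)
    assume *: "\<not> ?thesis"
    have "component {e. w e < p} y \<subseteq> component ?S y"
    proof (rule component_within)
      fix u v assume uv: "u \<in> component ?S y" "lattice_adj u v" "{u, v} \<in> {e. w e < p}"
      then have "l1 u < R" "l1 v \<le> R" using * lattice_adj_l1_le[of u v] by fastforce+
      with uv show "{u, v} \<in> ?S" by (auto simp: ball_edges_def lattice_ball_l1)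
    qed
    moreover have "component ?S y \<subseteq> lattice_ball R"
      using * by (force simp: lattice_ball_l1)
    ultimately have "component {e. w e < p} y \<subseteq> lattice_ball R" by (rule order_trans)
    then show False using assms(1) finite_subset[OF _ finite_lattice_ball] by blast
  qed
  then obtain z where z: "z \<in> component ?S y" "R \<le> l1 z" by blast
  obtain \<delta> where \<delta>: "\<delta> \<in> lattice_paths y z" "set (path_edges \<delta>) \<subseteq> ?S"
    "length (path_edges \<delta>) \<le> 2 * card ?S"
    using component_short_path[OF z(1)] by auto
  obtain \<eta> where \<eta>: "\<eta> \<in> lattice_paths 0 z" "path_edges \<eta> = path_edges \<pi> @ path_edges \<delta>"
    using lattice_path_join[OF assms(2) \<delta>(1)] .
  have "boundary_time K w R \<le> path_time K w \<eta>"
    by (rule boundary_time_le[OF \<eta>(1) z(2)])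
  also have "\<dots> = path_time K w \<pi> + path_time K w \<delta>"
    by (rule path_time_append[OF \<eta>(2)])
  also have "path_time K w \<delta> \<le> real (length (path_edges \<delta>)) * exp (K * p)"
    using \<delta>(2) assms(3) by (intro path_time_le) auto
  also have "\<dots> \<le> 2 * real (card (ball_edges R :: (int ^ 'd) set set)) * exp (K * p)"
  proof (rule mult_right_mono)
    have "card ?S \<le> card (ball_edges R :: (int ^ 'd) set set)" by (rule card_mono) auto
    with \<delta>(3) have "length (path_edges \<delta>) \<le> 2 * card (ball_edges R :: (int ^ 'd) set set)" by linarith
    then show "real (length (path_edges \<delta>)) \<le> 2 * real (card (ball_edges R :: (int ^ 'd) set set))"
      by linarith
  qed simp
  finally show ?thesis by simp
qed

lemma lattice_path_vertices:
  fixes \<gamma> :: "(int ^ 'd::finite) list"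
  assumes "\<gamma> \<in> lattice_paths 0 y"
  shows "set \<gamma> \<subseteq> lattice_ball (length (path_edges \<gamma>))"
  using assms
proof (induction rule: lattice_path_induct)
  case (extend \<gamma> y z)
  have "l1 z \<le> length (path_edges (\<gamma> @ [z]))"
    using lattice_path_l1[OF lattice_path_extend(1)[OF extend(1,2)]] by (simp add: l1_def)
  with extend show ?case by (auto simp: lattice_path_extend lattice_ball_l1)
qed (simp add: lattice_ball_l1)

text \<open>Nonnegative weights make every edge cost at least 1, so the paths no more expensive than
  \<open>\<gamma>0\<close> have bounded length and are finitely many. The predicate \<open>P\<close>
  allows minimizing over a set of endpoints.\<close>

lemma ex_minimal_path:
  fixes w :: "(int ^ 'd::finite) set \<Rightarrow> real"
  assumes nonneg: "\<forall>e\<in>lattice_edges. 0 \<le> w e" and "0 \<le> K"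
    and "\<gamma>0 \<in> lattice_paths 0 y0" "P y0"
  obtains \<gamma> y where "\<gamma> \<in> lattice_paths 0 y" "P y"
    "\<And>\<delta> z. \<delta> \<in> lattice_paths 0 z \<Longrightarrow> P z \<Longrightarrow> path_time K w \<gamma> \<le> path_time K w \<delta>"
proof -
  define N where "N = nat \<lfloor>path_time K w \<gamma>0\<rfloor>"
  define \<Gamma> where "\<Gamma> = {\<gamma>. \<exists>y. \<gamma> \<in> lattice_paths 0 y \<and> P y \<and> path_time K w \<gamma> \<le> path_time K w \<gamma>0}"
  have len: "real (length (path_edges \<gamma>)) \<le> path_time K w \<gamma>" if "\<gamma> \<in> lattice_paths 0 y" for \<gamma> y
  proof -
    have "(\<Sum>e\<leftarrow>path_edges \<gamma>. 1) \<le> path_time K w \<gamma>"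
      unfolding path_time_def using nonneg path_edges_lattice[OF that] \<open>0 \<le> K\<close>
      by (intro sum_list_mono) auto
    then show ?thesis by (simp add: sum_list_triv)
  qed
  have "\<Gamma> \<subseteq> {\<gamma>. set \<gamma> \<subseteq> lattice_ball N \<and> length \<gamma> \<le> Suc N}"
  proof
    fix \<gamma> assume "\<gamma> \<in> \<Gamma>"
    then obtain y where y: "\<gamma> \<in> lattice_paths 0 y" "path_time K w \<gamma> \<le> path_time K w \<gamma>0"
      by (auto simp: \<Gamma>_def)
    then have "length (path_edges \<gamma>) \<le> N"
      using len[OF y(1)] unfolding N_def by (simp add: le_nat_floor)
    moreover from this have "length \<gamma> \<le> Suc N" by (simp add: length_path_edges)
    ultimately show "\<gamma> \<in> {\<gamma>. set \<gamma> \<subseteq> lattice_ball N \<and> length \<gamma> \<le> Suc N}"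
      using lattice_path_vertices[OF y(1)] by (auto simp: lattice_ball_l1)
  qed
  then have fin: "finite \<Gamma>"
    using finite_lists_length_le[OF finite_lattice_ball] finite_subset by blast
  have "\<gamma>0 \<in> \<Gamma>" using assms(3,4) by (auto simp: \<Gamma>_def)
  then obtain \<gamma> where \<gamma>: "\<gamma> \<in> \<Gamma>" "\<And>\<delta>. \<delta> \<in> \<Gamma> \<Longrightarrow> path_time K w \<gamma> \<le> path_time K w \<delta>"
    using ex_min_if_finite[of "path_time K w ` \<Gamma>"] fin by (metis (no_types, lifting) arg_min_if_finite(1) arg_min_least empty_iff)
  from \<gamma>(1) obtain y where "\<gamma> \<in> lattice_paths 0 y" "P y" "path_time K w \<gamma> \<le> path_time K w \<gamma>0"
    by (auto simp: \<Gamma>_def)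
  moreover have "path_time K w \<gamma> \<le> path_time K w \<delta>" if "\<delta> \<in> lattice_paths 0 z" "P z" for \<delta> z
  proof (cases "path_time K w \<delta> \<le> path_time K w \<gamma>0")
    case True
    then show ?thesis using \<gamma>(2) that by (auto simp: \<Gamma>_def)
  next
    case False
    then show ?thesis using calculation(3) by linarith
  qed
  ultimately show ?thesis using that by blast
qed

text \<open>
  \<open>reached_early\<close> does not look at the edges of the ball around \<open>x\<close>. Once these edges are opened, the ball joins the
  infinite clusters and is the place where they are entered first, which can happen in only one of several
  distant balls.
\<close>

definition reached_early ::
    "real \<Rightarrow> real \<Rightarrow> nat \<Rightarrow> nat \<Rightarrow> int ^ 'd \<Rightarrow> ((int ^ 'd) set \<Rightarrow> real) \<Rightarrow> bool" where
  "reached_early K p n s x w \<longleftrightarrow>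
     (\<exists>b\<in>sball x n. infinite (component {e. w e < p \<and> e \<notin> sball_edges x n} b)) \<and>
     (\<forall>v\<in>sball x n. infinite (component {e. w e < p \<and> e \<notin> sball_edges x n} v) \<or>
        (\<forall>y. y \<in> component {e. w e < p \<and> e \<notin> sball_edges x n} v \<longrightarrow> y \<in> sball x s)) \<and>
     (\<exists>\<gamma> z. \<gamma> \<in> lattice_paths 0 z \<and> z \<in> sball x n \<and> (\<forall>e\<in>set (path_edges \<gamma>). e \<notin> sball_edges x n) \<and>
        (\<forall>\<pi> y. \<pi> \<in> lattice_paths 0 y \<longrightarrow> (\<forall>e\<in>set (path_edges \<pi>). e \<notin> sball_edges x n) \<longrightarrow>
           infinite (component {e. w e < p \<and> e \<notin> sball_edges x n} y) \<longrightarrow>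
           path_time K w \<gamma> < path_time K w \<pi>))"

text \<open>Compares individual paths instead of infima: the quantifiers range over countable sets,
  which keeps the event measurable.\<close>

definition entered_first ::
    "real \<Rightarrow> real \<Rightarrow> nat \<Rightarrow> int ^ 'd \<Rightarrow> ((int ^ 'd) set \<Rightarrow> real) \<Rightarrow> bool" where
  "entered_first K p s x w \<longleftrightarrow>
     (\<exists>z\<in>sball x s. infinite (component {e. w e < p} z)) \<and>
     (\<forall>\<pi> y. \<pi> \<in> lattice_paths 0 y \<longrightarrow> infinite (component {e. w e < p} y) \<longrightarrow> y \<notin> sball x s \<longrightarrow>
        (\<exists>\<gamma> z. \<gamma> \<in> lattice_paths 0 z \<and> z \<in> sball x s \<and> infinite (component {e. w e < p} z) \<and>
           path_time K w \<gamma> < path_time K w \<pi>))"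

text \<open>The scales: \<open>m\<close> confines the level-\<open>p'\<close> cluster of
  \<open>x\<close>; within radius \<open>n\<close> an infinite level-\<open>p\<close> cluster is at
  hand; \<open>s\<close> takes in the finite pieces attached to the ball of radius \<open>n\<close>,
  which join an infinite cluster once this ball is opened.\<close>

definition typical ::
    "real \<Rightarrow> real \<Rightarrow> nat \<Rightarrow> nat \<Rightarrow> nat \<Rightarrow> int ^ 'd \<Rightarrow> ((int ^ 'd) set \<Rightarrow> real) \<Rightarrow> bool" where
  "typical p p' m n s x w \<longleftrightarrow>
     (\<forall>y. y \<in> component {e. w e < p'} x \<longrightarrow> y \<in> sball x m) \<and>
     (\<exists>b\<in>sball x n. infinite (component {e. w e < p} b)) \<and>
     (\<forall>v\<in>sball x n. infinite (component {e. w e < p \<and> e \<notin> sball_edges x n} v) \<or>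
        (\<forall>y. y \<in> component {e. w e < p \<and> e \<notin> sball_edges x n} v \<longrightarrow> y \<in> sball x s))"

lemma pred_reached_early [measurable]:
  "Measurable.pred (weight_space :: ((int ^ 'd::finite) set \<Rightarrow> real) measure) (reached_early K p n s x)"
  unfolding reached_early_def by measurable

lemma pred_entered_first [measurable]:
  "Measurable.pred (weight_space :: ((int ^ 'd::finite) set \<Rightarrow> real) measure) (entered_first K p s x)"
  unfolding entered_first_def by measurable

lemma pred_typical [measurable]:
  "Measurable.pred (weight_space :: ((int ^ 'd::finite) set \<Rightarrow> real) measure) (typical p p' m n s x)"
  unfolding typical_def by measurable

lemma diff_open: "{e. w e < p \<and> e \<notin> F} = {e. w e < p} - F"
  by auto

text \<open>If a path into an infinite level-\<open>p\<close> cluster were as quick as the approach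
  \<open>\<delta>\<close> to the level-\<open>p'\<close> cluster of \<open>x\<close>, continuing
  along the infinite cluster would reach the boundary within the extra \<open>exp (K * p')\<close>
  that the path to \<open>x\<close> still has to pay for its entry edge.\<close>

lemma passage_less_boundary_imp_reached_early:
  fixes w :: "(int ^ 'd::finite) set \<Rightarrow> real"
  assumes "0 \<le> K" "p < p'" "m < n" "n < l1 x"
    and gap: "2 * real (card (ball_edges R :: (int ^ 'd) set set)) \<le> exp (K * (p' - p))"
    and usual: "typical p p' m n s x w"
    and less: "passage_time K w 0 x < boundary_time K w R"
  shows "reached_early K p n s x w"
proof -
  let ?F = "sball_edges x n"
  obtain \<gamma> where \<gamma>: "\<gamma> \<in> lattice_paths 0 x" "path_time K w \<gamma> < boundary_time K w R"
    using less unfolding passage_time_less_iff by blast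
  define A where "A = component {e. w e < p'} x"
  have A: "A \<subseteq> sball x m" using usual by (auto simp: typical_def A_def)
  have "0 \<notin> sball x m" using assms(3,4) l1_minus[of 0 x] by (simp add: mem_sball)
  then have "0 \<notin> A" "x \<in> A" using A by (auto simp: A_def)
  from path_crossing[OF \<gamma>(1) this, of K w] obtain u z \<delta> where
    \<delta>: "\<delta> \<in> lattice_paths 0 u" "u \<notin> A" "z \<in> A" "lattice_adj u z"
    "path_time K w \<delta> + exp (K * w {u, z}) \<le> path_time K w \<gamma>" by blast
  have adj: "lattice_adj z u" using \<delta>(4) by (simp only: lattice_adj_sym)
  have "\<not> w {z, u} < p'"
    using \<delta>(2,3) adj component_step[of z _ x u] unfolding A_def by auto
  then have "exp (K * p') \<le> exp (K * w {u, z})"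
    using \<open>0 \<le> K\<close> by (simp add: insert_commute mult_left_mono)
  with \<delta>(5) have \<delta>p': "path_time K w \<delta> + exp (K * p') \<le> path_time K w \<gamma>" by linarith
  \<comment> \<open>The entry edge reaches one step beyond radius \<open>m\<close>, which
    \<open>m < n\<close> absorbs.\<close>
  have "u \<in> sball x n"
  proof -
    have "l1 (u - x) \<le> l1 (u - z) + l1 (z - x)" using l1_triangle[of "u - z" "z - x"] by simp
    moreover have "l1 (z - x) \<le> m" using \<delta>(3) A by (auto simp: mem_sball)
    ultimately show ?thesis using \<delta>(4) \<open>m < n\<close> by (simp add: mem_sball lattice_adj_l1)
  qed
  then obtain v \<eta> where \<eta>: "v \<in> sball x n" "\<eta> \<in> lattice_paths 0 v"
    "\<forall>e\<in>set (path_edges \<eta>). \<not> e \<subseteq> sball x n" "path_time K w \<eta> \<le> path_time K w \<delta>"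
    using path_first_hit[OF \<delta>(1), of "sball x n" K w] by blast
  have "path_time K w \<eta> < path_time K w \<pi>"
    if \<pi>: "\<pi> \<in> lattice_paths 0 y" "infinite (component {e. w e < p \<and> e \<notin> ?F} y)" for \<pi> y
  proof (rule ccontr)
    assume "\<not> ?thesis"
    moreover have "component {e. w e < p \<and> e \<notin> ?F} y \<subseteq> component {e. w e < p} y"
      by (rule component_mono) auto
    then have "infinite (component {e. w e < p} y)" using \<pi>(2) finite_subset by blast
    from boundary_time_via_cluster[OF this \<pi>(1) \<open>0 \<le> K\<close>, of R]
    have "boundary_time K w R
        \<le> path_time K w \<pi> + 2 * real (card (ball_edges R :: (int ^ 'd) set set)) * exp (K * p)" .
    moreover have "2 * real (card (ball_edges R :: (int ^ 'd) set set)) * exp (K * p)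
        \<le> exp (K * (p' - p)) * exp (K * p)"
      using gap by (rule mult_right_mono) simp
    moreover have "exp (K * (p' - p)) * exp (K * p) = exp (K * p')"
      by (simp add: exp_add[symmetric] algebra_simps)
    ultimately show False using \<eta>(4) \<delta>p' \<gamma>(2) by linarith
  qed
  moreover have "\<forall>e\<in>set (path_edges \<eta>). e \<notin> ?F"
    using \<eta>(3) by (auto simp: sball_edges_eq)
  moreover have "\<exists>b\<in>sball x n. infinite (component {e. w e < p \<and> e \<notin> ?F} b)"
  proof -
    obtain b where b: "b \<in> sball x n" "infinite (component {e. w e < p} b)"
      using usual by (auto simp: typical_def)
    from infinite_component_last_visit[OF b(2) sball_edges_Pow finite_sball b(1)] show ?thesis
      unfolding diff_open by blast
  qed
  ultimately show ?thesis
    using usual \<eta>(1,2) unfolding reached_early_def typical_def by blast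
qed

text \<open>Opening the ball puts all its vertices into one infinite cluster. A path that meets the
  ball is beaten by its own part up to the first hit. A path that avoids it and ends outside
  \<open>sball x s\<close> ends in a component that is infinite even without the ball edges, as
  finite pieces meeting the ball stay in \<open>sball x s\<close>; it is beaten by the path from
  \<open>reached_early\<close>.\<close>

lemma reached_early_imp_entered_first:
  fixes w :: "(int ^ 'd::finite) set \<Rightarrow> real"
  assumes early: "reached_early K p n s x w" and opn: "\<forall>e\<in>sball_edges x n. w e < p" and "n \<le> s"
  shows "entered_first K p s x w"
proof -
  let ?F = "sball_edges x n"
  let ?O = "{e. w e < p}"
  have F: "?F \<subseteq> ?O" using opn by auto
  obtain b where b: "b \<in> sball x n" "infinite (component (?O - ?F) b)"
    using early unfolding reached_early_def diff_open by blast
  have inf: "infinite (component ?O v)" if "v \<in> sball x n" for v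
  proof -
    have "component ?O v = component ?O b"
      using sball_connected2[OF that b(1) F] by (rule component_eq[symmetric])
    then show ?thesis using b(2) component_mono[of "?O - ?F" ?O b] finite_subset by fastforce
  qed
  have sub: "sball x n \<subseteq> sball x s" using \<open>n \<le> s\<close> by (rule sball_mono)
  obtain \<gamma>0 z0 where \<gamma>0: "\<gamma>0 \<in> lattice_paths 0 z0" "z0 \<in> sball x n"
    "\<And>\<pi> y. \<pi> \<in> lattice_paths 0 y \<Longrightarrow> (\<forall>e\<in>set (path_edges \<pi>). e \<notin> ?F) \<Longrightarrow>
       infinite (component (?O - ?F) y) \<Longrightarrow> path_time K w \<gamma>0 < path_time K w \<pi>"
    using early unfolding reached_early_def diff_open by blast
  have small: "component (?O - ?F) v \<subseteq> sball x s"
    if "v \<in> sball x n" "finite (component (?O - ?F) v)" for v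
    using early that unfolding reached_early_def diff_open by blast
  have "\<exists>\<gamma> z. \<gamma> \<in> lattice_paths 0 z \<and> z \<in> sball x s \<and> infinite (component ?O z) \<and>
      path_time K w \<gamma> < path_time K w \<pi>"
    if \<pi>: "\<pi> \<in> lattice_paths 0 y" "infinite (component ?O y)" "y \<notin> sball x s" for \<pi> y
  proof -
    have "y \<notin> sball x n" using \<pi>(3) sub by blast
    with path_first_hit[OF \<pi>(1), of "sball x n" K w] consider
      z \<delta> where "z \<in> sball x n" "\<delta> \<in> lattice_paths 0 z" "path_time K w \<delta> < path_time K w \<pi>"
      | "\<forall>e\<in>set (path_edges \<pi>). \<not> e \<subseteq> sball x n" by blast
    then show ?thesis
    proof cases
      case 1
      then show ?thesis using inf sub by blast
    next
      case 2
      then have avoid: "\<forall>e\<in>set (path_edges \<pi>). e \<notin> ?F" by (auto simp: sball_edges_eq)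
      have "infinite (component (?O - ?F) y)"
      proof
        assume fin: "finite (component (?O - ?F) y)"
        have "\<exists>v\<in>sball x n. v \<in> component (?O - ?F) y"
        proof (rule ccontr)
          assume *: "\<not> ?thesis"
          have "component ?O y \<subseteq> component (?O - ?F) y"
            by (rule component_within) (use * in \<open>auto simp: sball_edges_eq\<close>)
          then show False using fin \<pi>(2) finite_subset by blast
        qed
        then obtain v where v: "v \<in> sball x n" "v \<in> component (?O - ?F) y" by blast
        then have "component (?O - ?F) v = component (?O - ?F) y" by (intro component_eq)
        with small[OF v(1)] fin component_refl[of y "?O - ?F"] \<pi>(3) show False by auto
      qed
      then show ?thesis using \<gamma>0(3)[OF \<pi>(1) avoid] \<gamma>0(1,2) inf sub by blast
    qed
  qed
  moreover have "\<exists>z\<in>sball x s. infinite (component ?O z)" using b(1) inf sub by blast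
  ultimately show ?thesis unfolding entered_first_def by blast
qed

text \<open>Take a quickest path to an infinite cluster within the two balls. If they were disjoint,
  one of them would miss its endpoint and supply a strictly quicker path.\<close>

lemma entered_first_unique:
  fixes w :: "(int ^ 'd::finite) set \<Rightarrow> real"
  assumes nonneg: "\<forall>e\<in>lattice_edges. 0 \<le> w e" and "0 \<le> K"
    and "entered_first K p s x w" "entered_first K p s x' w"
  shows "sball x s \<inter> sball x' s \<noteq> {}"
proof
  assume disj: "sball x s \<inter> sball x' s = {}"
  define P where "P z \<longleftrightarrow> infinite (component {e. w e < p} z) \<and> z \<in> sball x s \<union> sball x' s" for z
  obtain z0 where "P z0" using assms(3) by (auto simp: entered_first_def P_def)
  moreover obtain \<gamma>0 where "\<gamma>0 \<in> lattice_paths 0 z0" using lattice_paths_nonempty by blast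
  ultimately obtain \<gamma> y where \<gamma>: "\<gamma> \<in> lattice_paths 0 y" "P y"
    "\<And>\<delta> z. \<delta> \<in> lattice_paths 0 z \<Longrightarrow> P z \<Longrightarrow> path_time K w \<gamma> \<le> path_time K w \<delta>"
    using ex_minimal_path[OF nonneg \<open>0 \<le> K\<close>] by blast
  have False if v: "entered_first K p s v w" "y \<notin> sball v s" "sball v s \<subseteq> sball x s \<union> sball x' s" for v
  proof -
    obtain \<delta> z where \<delta>: "\<delta> \<in> lattice_paths 0 z" "z \<in> sball v s" "infinite (component {e. w e < p} z)"
      "path_time K w \<delta> < path_time K w \<gamma>"
      using v(1,2) \<gamma>(1,2) unfolding entered_first_def P_def by blast
    then have "P z" using v(3) unfolding P_def by blast
    with \<gamma>(3)[OF \<delta>(1)] \<delta>(4) show False by (meson not_le)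
  qed
  moreover have "y \<notin> sball x s \<or> y \<notin> sball x' s" using disj by blast
  ultimately show False using assms(3,4) by blast
qed

section \<open>No percolation at criticality\<close>

text \<open>A finite cluster has finitely many edges around it and almost surely none of weight
  exactly \<open>p\<close>, so a slightly higher level does not enlarge it.\<close>

lemma percolation_right_continuous:
  assumes "percolation_prob TYPE('d::finite) p < a"
  shows "\<forall>\<^sub>F k in sequentially. percolation_prob TYPE('d) (p + 1 / Suc k) < a"
proof -
  let ?M = "weight_space :: ((int ^ 'd) set \<Rightarrow> real) measure"
  define Q where "Q k w \<longleftrightarrow> finite (component {e. w e < p + 1 / Suc k} (0 :: int ^ 'd))"
    for k and w :: "(int ^ 'd) set \<Rightarrow> real"
  have [measurable]: "Measurable.pred ?M (Q k)" for k unfolding Q_def by measurable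
  have "AE w in ?M. finite (component {e. w e < p} (0 :: int ^ 'd)) \<longrightarrow> (\<exists>k. Q k w)"
    using AE_weight_neq[of p]
  proof eventually_elim
    case (elim w)
    show ?case
    proof
      let ?D = "component {e. w e < p} (0 :: int ^ 'd)"
      assume fin: "finite ?D"
      then obtain n where n: "?D \<subseteq> lattice_ball n"
        using infinite_iff_leaves_balls[of ?D] by blast
      \<comment> \<open>Radius \<open>Suc n\<close> also covers the edges that leave the ball of
        radius \<open>n\<close>.\<close>
      have "\<forall>\<^sub>F k in sequentially. \<forall>e\<in>ball_edges (Suc n). p < w e \<longrightarrow> p + 1 / Suc k < w e"
      proof (rule eventually_ball_finite)
        show "\<forall>e\<in>ball_edges (Suc n). \<forall>\<^sub>F k in sequentially. p < w e \<longrightarrow> p + 1 / Suc k < w e"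
        proof
          fix e :: "(int ^ 'd) set"
          show "\<forall>\<^sub>F k in sequentially. p < w e \<longrightarrow> p + 1 / Suc k < w e"
          proof (cases "p < w e")
            case True
            have "(\<lambda>k. p + 1 / Suc k) \<longlonglongrightarrow> p + 0"
              by (intro tendsto_intros LIMSEQ_inverse_real_of_nat[unfolded inverse_eq_divide])
            with True have "\<forall>\<^sub>F k in sequentially. p + 1 / Suc k < w e"
              by (intro order_tendstoD) auto
            then show ?thesis by (rule eventually_mono) simp
          qed simp
        qed
      qed simp
      then obtain k where k: "\<forall>e\<in>ball_edges (Suc n). p < w e \<longrightarrow> p + 1 / Suc k < w e"
        by (auto simp: eventually_sequentially)
      have "component {e. w e < p + 1 / Suc k} 0 \<subseteq> ?D"
      proof (rule component_within)
        fix u v assume uv: "u \<in> ?D" "lattice_adj u v" "{u, v} \<in> {e. w e < p + 1 / Suc k}"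
        have "l1 u \<le> n" using uv(1) n by (auto simp: lattice_ball_l1)
        then have "{u, v} \<in> ball_edges (Suc n)"
          using uv(2) lattice_adj_l1_le[OF uv(2)] by (auto simp: ball_edges_def lattice_ball_l1)
        moreover have "w {u, v} \<noteq> p" using elim uv(2) by simp
        ultimately show "{u, v} \<in> {e. w e < p}" using k uv(3) by force
      qed
      then show "\<exists>k. Q k w" unfolding Q_def using fin finite_subset by blast
    qed
  qed
  then have "\<P>(w in ?M. finite (component {e. w e < p} (0 :: int ^ 'd))) \<le> \<P>(w in ?M. \<exists>k. Q k w)"
    by (intro W.finite_measure_mono_AE) auto
  moreover have "1 - a < \<P>(w in ?M. finite (component {e. w e < p} (0 :: int ^ 'd)))"
    using assms unfolding percolation_prob_eq by (subst (asm) weight_prob_not) auto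
  ultimately have "1 - a < \<P>(w in ?M. \<exists>k. Q k w)" by linarith
  moreover have "Q k w" if "j \<le> k" "Q j w" for j k w
  proof -
    have "1 / real (Suc k) \<le> 1 / real (Suc j)" using that(1) by (simp add: frac_le)
    then have "component {e. w e < p + 1 / Suc k} 0 \<subseteq> component {e. w e < p + 1 / Suc j} (0 :: int ^ 'd)"
      by (intro component_mono) auto
    with that(2) show ?thesis unfolding Q_def using finite_subset by blast
  qed
  ultimately have "\<forall>\<^sub>F k in sequentially. 1 - a < \<P>(w in ?M. Q k w)"
    by (intro prob_incseq_eventually) auto
  then show ?thesis
  proof eventually_elim
    case (elim k)
    then show ?case
      unfolding percolation_prob_eq by (subst weight_prob_not) (auto simp: Q_def)
  qed
qed

text \<open>Existence of an infinite cluster does not depend on finitely many edges, so the zero-one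
  law lifts positive probability to 1.\<close>

lemma prob_ex_infinite_cluster:
  assumes "percolation_prob TYPE('d::finite) p > 0"
  shows "\<P>(w in weight_space. \<exists>z :: int ^ 'd. infinite (component {e. w e < p} z)) = 1"
proof -
  let ?A = "{w \<in> space weight_space. \<exists>z :: int ^ 'd. infinite (component {e. w e < p} z)}"
  have "percolation_prob TYPE('d) p \<le> W.prob ?A"
    unfolding percolation_prob_eq by (intro W.finite_measure_mono) auto
  moreover have "W.prob ?A = 0 \<or> W.prob ?A = 1"
  proof (rule zero_one_law)
    fix F :: "(int ^ 'd) set set" assume F: "finite F" "F \<subseteq> lattice_edges"
    show "ignores ?A F"
    proof (rule ignoresI)
      fix w w' :: "(int ^ 'd) set \<Rightarrow> real"
      assume eq: "\<forall>e\<in>lattice_edges - F. w e = w' e"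
        and "\<exists>z. infinite (component {e. w e < p} z)"
      then obtain z where z: "infinite (component {e. w e < p} z)" by blast
      \<comment> \<open>\<open>z\<close> is added because the starting point has to lie in the
        finite set.\<close>
      have "finite (insert z (\<Union>F))"
        using F by (auto simp: lattice_edges_def)
      then obtain b where "infinite (component ({e. w e < p} - F) b)"
        using infinite_component_last_visit[OF z, of F "insert z (\<Union>F)"] by blast
      moreover have "component ({e. w e < p} - F) b = component ({e. w' e < p} - F) b"
        using eq by (intro component_cong) auto
      moreover have "component ({e. w' e < p} - F) b \<subseteq> component {e. w' e < p} b"
        by (rule component_mono) auto
      ultimately show "\<exists>z. infinite (component {e. w' e < p} z)"
        using finite_subset by metis
    qed
  qed measurable
  ultimately show ?thesis using assms by linarith
qed

lemma typical_shift:
  fixes x :: "int ^ 'd::finite"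
  shows "typical p p' m n s x w \<longleftrightarrow> typical p p' m n s 0 (shift x w)"
proof -
  have mem: "(\<forall>y. y \<in> (\<lambda>u. u + x) ` A \<longrightarrow> y \<in> sball x k) \<longleftrightarrow> (\<forall>y. y \<in> A \<longrightarrow> y \<in> sball 0 k)" for A k
    by (auto simp: mem_sball lattice_ball_l1)
  have inf: "infinite ((\<lambda>u. u + x) ` A) \<longleftrightarrow> infinite A" for A
    by (simp add: finite_image_iff)
  have ball: "(\<forall>v\<in>sball x k. P v) \<longleftrightarrow> (\<forall>v\<in>sball 0 k. P (v + x))"
    "(\<exists>v\<in>sball x k. P v) \<longleftrightarrow> (\<exists>v\<in>sball 0 k. P (v + x))" for k P
    by (auto simp: sball_def)
  have "component {e. w e < p'} x = (\<lambda>u. u + x) ` component {e. shift x w e < p'} 0"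
    using component_shift_open[of w p' 0 x] by simp
  then show ?thesis
    unfolding typical_def ball component_shift_open component_shift_off inf mem sball_edges_0
    by (simp only: mem)
qed

text \<open>The scales are chosen in the order \<open>m\<close>, \<open>n\<close>, \<open>s\<close>,
  each by continuity from below; each of the three clauses fails with probability less than
  \<open>\<eta>\<close>.\<close>

lemma ex_typical_scales:
  fixes p p' \<eta> :: real
  assumes "0 < \<eta>" "percolation_prob TYPE('d::finite) p > 0" "percolation_prob TYPE('d) p' < \<eta>"
  obtains m n s where "m < n" "n \<le> s"
    "\<And>x :: int ^ 'd. \<P>(w in weight_space. \<not> typical p p' m n s x w) \<le> 3 * \<eta>"
proof -
  let ?M = "weight_space :: ((int ^ 'd) set \<Rightarrow> real) measure"
  let ?F = "\<lambda>n. ball_edges n :: (int ^ 'd) set set"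
  define Q1 where "Q1 m w \<longleftrightarrow> (\<forall>y. y \<in> component {e. w e < p'} (0 :: int ^ 'd) \<longrightarrow> y \<in> lattice_ball m)"
    for m w
  define Q2 where "Q2 n w \<longleftrightarrow> (\<exists>b\<in>lattice_ball n. infinite (component {e. w e < p} (b :: int ^ 'd)))"
    for n w
  define Q3 where "Q3 n s w \<longleftrightarrow> (\<forall>v\<in>lattice_ball n. infinite (component {e. w e < p \<and> e \<notin> ?F n} v) \<or>
        (\<forall>y. y \<in> component {e. w e < p \<and> e \<notin> ?F n} v \<longrightarrow> y \<in> lattice_ball s))" for n s w
  have [measurable]: "Measurable.pred ?M (Q1 k)" "Measurable.pred ?M (Q2 k)" "Measurable.pred ?M (Q3 j k)"
    for j k unfolding Q1_def Q2_def Q3_def by measurable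
  have balls: "lattice_ball j \<subseteq> (lattice_ball k :: (int ^ 'd) set)" if "j \<le> k" for j k
    using that by (auto simp: lattice_ball_l1)
  have "(\<exists>m. Q1 m w) \<longleftrightarrow> finite (component {e. w e < p'} (0 :: int ^ 'd))" for w
    using infinite_iff_leaves_balls[of "component {e. w e < p'} (0 :: int ^ 'd)"]
    unfolding Q1_def by blast
  then have "1 - \<eta> < \<P>(w in ?M. \<exists>m. Q1 m w)"
    using assms(3) unfolding percolation_prob_eq by (subst (asm) weight_prob_not) auto
  then have "\<forall>\<^sub>F m in sequentially. 1 - \<eta> < \<P>(w in ?M. Q1 m w)"
    by (intro prob_incseq_eventually) (use balls in \<open>auto simp: Q1_def\<close>)
  then obtain m where m: "1 - \<eta> < \<P>(w in ?M. Q1 m w)" by (auto simp: eventually_sequentially)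
  have "(\<exists>n. Q2 n w) \<longleftrightarrow> (\<exists>z :: int ^ 'd. infinite (component {e. w e < p} z))" for w
    unfolding Q2_def by (auto simp: lattice_ball_l1)
  then have "1 - \<eta> < \<P>(w in ?M. \<exists>n. Q2 n w)"
    using prob_ex_infinite_cluster[OF assms(2)] assms(1) by simp
  then have "\<forall>\<^sub>F n in sequentially. 1 - \<eta> < \<P>(w in ?M. Q2 n w)"
    by (intro prob_incseq_eventually) (use balls in \<open>auto simp: Q2_def\<close>)
  then have "\<forall>\<^sub>F n in sequentially. 1 - \<eta> < \<P>(w in ?M. Q2 n w) \<and> m < n"
    by (intro eventually_conj eventually_gt_at_top)
  then obtain n where n: "1 - \<eta> < \<P>(w in ?M. Q2 n w)" "m < n"
    by (auto simp: eventually_sequentially)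
  \<comment> \<open>Only finitely many components start in the ball of radius \<open>n\<close>, so
    the finite ones fit into a common ball.\<close>
  have "\<exists>s. Q3 n s w" for w
  proof -
    define D where "D = (\<Union>v\<in>{v\<in>lattice_ball n. finite (component {e. w e < p \<and> e \<notin> ?F n} v)}.
      component {e. w e < p \<and> e \<notin> ?F n} v)"
    have "finite D" by (auto simp: D_def)
    then obtain s where "D \<subseteq> lattice_ball s" using infinite_iff_leaves_balls[of D] by blast
    then have "Q3 n s w" unfolding Q3_def D_def by blast
    then show ?thesis ..
  qed
  then have "1 - \<eta> < \<P>(w in ?M. \<exists>s. Q3 n s w)" using assms(1) by (simp add: W.prob_space)
  then have "\<forall>\<^sub>F s in sequentially. 1 - \<eta> < \<P>(w in ?M. Q3 n s w)"
  proof (rule prob_incseq_eventually[rotated 2])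
    show "Q3 n k w" if "j \<le> k" "Q3 n j w" for j k w
      using that balls[of j k] unfolding Q3_def by blast
  qed measurable
  then have "\<forall>\<^sub>F s in sequentially. 1 - \<eta> < \<P>(w in ?M. Q3 n s w) \<and> n \<le> s"
    by (intro eventually_conj eventually_ge_at_top)
  then obtain s where s: "1 - \<eta> < \<P>(w in ?M. Q3 n s w)" "n \<le> s"
    by (auto simp: eventually_sequentially)
  show ?thesis
  proof
    fix x :: "int ^ 'd"
    have "\<P>(w in ?M. \<not> typical p p' m n s x w) = \<P>(w in ?M. \<not> typical p p' m n s 0 w)"
      unfolding typical_shift[of p p' m n s x]
      by (rule prob_shift[of "\<lambda>w. \<not> typical p p' m n s 0 w"]) measurable
    also have "{w \<in> space ?M. \<not> typical p p' m n s 0 w}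
        = {w \<in> space ?M. \<not> Q1 m w} \<union> {w \<in> space ?M. \<not> Q2 n w} \<union> {w \<in> space ?M. \<not> Q3 n s w}"
      unfolding typical_def Q1_def Q2_def Q3_def sball_0 sball_edges_0 by blast
    also have "W.prob \<dots> \<le> \<P>(w in ?M. \<not> Q1 m w) + \<P>(w in ?M. \<not> Q2 n w) + \<P>(w in ?M. \<not> Q3 n s w)"
      by (intro order_trans[OF measure_Un_le] add_mono order_refl measure_Un_le) auto
    also have "\<dots> \<le> 3 * \<eta>"
      using m n(1) s(1) by (simp add: weight_prob_not)
    finally show "\<P>(w in ?M. \<not> typical p p' m n s x w) \<le> 3 * \<eta>" .
  qed (use n s in auto)
qed

lemma reached_early_ignores:
  fixes x :: "int ^ 'd::finite"
  shows "ignores {w \<in> space weight_space. reached_early K p n s x w} (sball_edges x n)"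
proof (rule ignoresI)
  fix w w' :: "(int ^ 'd) set \<Rightarrow> real"
  let ?F = "sball_edges x n"
  assume eq: "\<forall>e\<in>lattice_edges - ?F. w e = w' e" and early: "reached_early K p n s x w"
  have comp: "component {e. w e < p \<and> e \<notin> ?F} y = component {e. w' e < p \<and> e \<notin> ?F} y" for y
    using eq by (intro component_cong) auto
  have time: "path_time K w \<gamma> = path_time K w' \<gamma>"
    if "\<gamma> \<in> lattice_paths 0 y" "\<forall>e\<in>set (path_edges \<gamma>). e \<notin> ?F" for \<gamma> y
  proof -
    have "map (\<lambda>e. exp (K * w e)) (path_edges \<gamma>) = map (\<lambda>e. exp (K * w' e)) (path_edges \<gamma>)"
      using eq that path_edges_lattice[OF that(1)] by (intro map_cong) auto
    then show ?thesis unfolding path_time_def by (rule arg_cong)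
  qed
  obtain \<gamma> z where "\<gamma> \<in> lattice_paths 0 z" "z \<in> sball x n" "\<forall>e\<in>set (path_edges \<gamma>). e \<notin> ?F"
    "\<And>\<pi> y. \<pi> \<in> lattice_paths 0 y \<Longrightarrow> (\<forall>e\<in>set (path_edges \<pi>). e \<notin> ?F) \<Longrightarrow>
       infinite (component {e. w e < p \<and> e \<notin> ?F} y) \<Longrightarrow> path_time K w \<gamma> < path_time K w \<pi>"
    using early unfolding reached_early_def by blast
  then have "\<exists>\<gamma> z. \<gamma> \<in> lattice_paths 0 z \<and> z \<in> sball x n \<and> (\<forall>e\<in>set (path_edges \<gamma>). e \<notin> ?F) \<and>
      (\<forall>\<pi> y. \<pi> \<in> lattice_paths 0 y \<longrightarrow> (\<forall>e\<in>set (path_edges \<pi>). e \<notin> ?F) \<longrightarrow>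
         infinite (component {e. w' e < p \<and> e \<notin> ?F} y) \<longrightarrow> path_time K w' \<gamma> < path_time K w' \<pi>)"
    using time comp by (intro exI[of _ \<gamma>] exI[of _ z]) (metis (no_types, lifting))
  then show "reached_early K p n s x w'"
    using early unfolding reached_early_def comp by blast
qed

lemma sum_prob_entered_first_le:
  fixes x :: "nat \<Rightarrow> int ^ 'd::finite"
  assumes "0 \<le> K" "\<And>j k. j \<noteq> k \<Longrightarrow> sball (x j) s \<inter> sball (x k) s = {}"
  shows "(\<Sum>k<N. \<P>(w in weight_space. entered_first K p s (x k) w)) \<le> 1"
proof -
  have "(\<Sum>k<N. \<P>(w in weight_space. entered_first K p s (x k) w)) \<le> real 1"
  proof (rule sum_prob_le)
    show "AE w in weight_space. card {k \<in> {..<N}. entered_first K p s (x k) w} \<le> 1"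
      using AE_weight_nonneg
    proof eventually_elim
      case (elim w)
      have "j = k" if "entered_first K p s (x j) w" "entered_first K p s (x k) w" for j k
        using entered_first_unique[OF elim assms(1) that] assms(2) by blast
      then show ?case by (auto simp: card_le_Suc0_iff_eq)
    qed
  qed auto
  then show ?thesis by simp
qed

text \<open>Off the atypical event the point is reached early; dividing by the power of
  \<open>p\<close> is the price of opening the ball to obtain \<open>entered_first\<close>.\<close>

lemma passage_prob_le:
  fixes x :: "int ^ 'd::finite"
  assumes "0 \<le> K" "0 < p" "p \<le> 1" "p < p'" "m < n" "n \<le> s" "n < l1 x"
    and gap: "2 * real (card (ball_edges R :: (int ^ 'd) set set)) \<le> exp (K * (p' - p))"
  shows "\<P>(w in weight_space. passage_time K w 0 x < boundary_time K w R)
    \<le> \<P>(w in weight_space. \<not> typical p p' m n s x w)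
      + \<P>(w in weight_space. entered_first K p s x w) / p ^ card (ball_edges n :: (int ^ 'd) set set)"
proof -
  let ?M = "weight_space :: ((int ^ 'd) set \<Rightarrow> real) measure"
  let ?T = "{w \<in> space ?M. \<not> typical p p' m n s x w}"
  let ?A = "{w \<in> space ?M. reached_early K p n s x w}"
  have "\<P>(w in ?M. passage_time K w 0 x < boundary_time K w R) \<le> W.prob (?T \<union> ?A)"
    using passage_less_boundary_imp_reached_early[OF assms(1,4,5,7) gap]
    by (intro W.finite_measure_mono) auto
  also have "\<dots> \<le> W.prob ?T + W.prob ?A"
    by (rule measure_Un_le) auto
  also have "W.prob ?A \<le> \<P>(w in ?M. entered_first K p s x w) / p ^ card (ball_edges n :: (int ^ 'd) set set)"
  proof -
    have "p ^ card (sball_edges x n) * W.prob ?A \<le> \<P>(w in ?M. entered_first K p s x w)"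
      using assms sball_edges_lattice reached_early_imp_entered_first
      by (intro prob_open_ignores reached_early_ignores) auto
    then show ?thesis using \<open>0 < p\<close> by (simp add: card_sball_edges field_simps)
  qed
  finally show ?thesis by simp
qed

text \<open>An average over \<open>N\<close> points: almost surely at most one of them has
  \<open>entered_first\<close>, so for large \<open>R\<close> the probabilities sum to at most
  \<open>4 * \<eta> * N\<close>. As the points do not depend on \<open>R\<close>, a liminf above
  \<open>a\<close> at each of them would contradict this.\<close>

lemma ex_liminf_le:
  fixes e a :: real
  defines "K \<equiv> \<lambda>R. K_param TYPE('d::finite) R e"
  assumes e: "0 < e" "e \<le> 1" and "0 < a"
    and crit: "percolation_prob TYPE('d) (critical_prob TYPE('d)) = 0"
  shows "\<exists>x :: int ^ 'd. liminf (\<lambda>R. ereal (\<P>(w in weight_space.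
    passage_time (K R) w 0 x < boundary_time (K R) w R))) \<le> ereal a"
proof -
  \<comment> \<open>Of five parts, three pay for atypical configurations and one for
    \<open>entered_first\<close>; the last leaves a strict margin.\<close>
  define \<eta> where "\<eta> = a / 5"
  have "\<eta> > 0" using \<open>0 < a\<close> by (simp add: \<eta>_def)
  let ?pc = "critical_prob TYPE('d)"
  have "?pc \<noteq> 1" using crit percolation_prob_1[where 'd = 'd] by auto
  then have "?pc < 1" using critical_prob_bounds(2)[where 'd = 'd] by linarith
  have "(\<lambda>k. ?pc + 1 / Suc k) \<longlonglongrightarrow> ?pc + 0"
    by (intro tendsto_intros LIMSEQ_inverse_real_of_nat[unfolded inverse_eq_divide])
  then have "\<forall>\<^sub>F k in sequentially. ?pc + 1 / Suc k < 1"
    using \<open>?pc < 1\<close> by (intro order_tendstoD) auto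
  moreover have "\<forall>\<^sub>F k in sequentially. percolation_prob TYPE('d) (?pc + 1 / Suc k) < \<eta>"
    using crit \<open>\<eta> > 0\<close> by (intro percolation_right_continuous) simp
  ultimately have "\<forall>\<^sub>F k in sequentially. ?pc + 1 / Suc k < 1 \<and> percolation_prob TYPE('d) (?pc + 1 / Suc k) < \<eta>"
    by (rule eventually_conj)
  then obtain k where k: "?pc + 1 / Suc k < 1" "percolation_prob TYPE('d) (?pc + 1 / Suc k) < \<eta>"
    by (auto simp: eventually_sequentially)
  define p' where "p' = ?pc + 1 / Suc k"
  define p where "p = (?pc + p') / 2"
  have "?pc < p'" "p' < 1" using k(1) by (auto simp: p'_def)
  then have p: "?pc < p" "p < p'" "0 < p" "p \<le> 1"
    using critical_prob_bounds(1)[where 'd = 'd] by (auto simp: p_def)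
  obtain m n s where mns: "m < n" "n \<le> s"
    "\<And>x :: int ^ 'd. \<P>(w in weight_space. \<not> typical p p' m n s x w) \<le> 3 * \<eta>"
    using ex_typical_scales[OF \<open>\<eta> > 0\<close> percolation_above_critical[OF p(1)] k(2)[folded p'_def]] by blast
  \<comment> \<open>The mesh makes the balls of radius \<open>s\<close> disjoint; starting at
    \<open>k + 1\<close> keeps the origin at distance more than \<open>n\<close> from all these
    points.\<close>
  define x :: "nat \<Rightarrow> int ^ 'd" where "x k = stretch (2 * s + 1) (axis undefined (int k + 1))" for k
  have l1_x: "l1 (x j - x k) = (2 * s + 1) * nat \<bar>int j - int k\<bar>" for j k
  proof -
    have "axis undefined (int j + 1) - axis undefined (int k + 1) = (axis undefined (int j - int k) :: int ^ 'd)"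
      by (simp add: axis_def vec_eq_iff)
    then show ?thesis unfolding x_def l1_stretch by simp
  qed
  have far: "n < l1 (x k)" for k
  proof -
    have "stretch (2 * s + 1) 0 = (0 :: int ^ 'd)" by (simp add: stretch_def vec_eq_iff)
    then have "l1 (x k) = (2 * s + 1) * nat \<bar>int k + 1\<bar>"
      using l1_stretch[of "2 * s + 1" "axis undefined (int k + 1) :: int ^ 'd" 0] by (simp add: x_def)
    moreover have "(2 * s + 1) * 1 \<le> (2 * s + 1) * nat \<bar>int k + 1\<bar>" by (intro mult_left_mono) auto
    ultimately have "(2 * s + 1) * 1 \<le> l1 (x k)" by (simp only:)
    moreover have "n < (2 * s + 1) * 1" using mns(2) by simp
    ultimately show ?thesis by (rule less_le_trans[rotated])
  qed
  have disj: "sball (x j) s \<inter> sball (x k) s = {}" if "j \<noteq> k" for j k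
  proof (rule ccontr)
    assume "sball (x j) s \<inter> sball (x k) s \<noteq> {}"
    then obtain v where "l1 (v - x j) \<le> s" "l1 (v - x k) \<le> s" by (auto simp: mem_sball)
    then have "l1 (x j - x k) \<le> 2 * s"
      using l1_triangle[of "x j - v" "v - x k"] by (simp add: l1_minus[of v "x j"])
    moreover have "(2 * s + 1) * 1 \<le> l1 (x j - x k)"
      unfolding l1_x using that by (intro mult_left_mono) auto
    ultimately show False by simp
  qed
  define c where "c = p ^ card (ball_edges n :: (int ^ 'd) set set)"
  have "c > 0" using p by (simp add: c_def)
  \<comment> \<open>Makes \<open>1 / c\<close>, the bound on the sum of all
    \<open>entered_first\<close> terms, at most \<open>\<eta> * N\<close>.\<close>
  obtain N where N: "1 / (c * \<eta>) < real N" using reals_Archimedean2 by blast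
  have "N > 0"
  proof (rule ccontr)
    assume "\<not> N > 0"
    with N have "1 / (c * \<eta>) < 0" by simp
    moreover have "1 / (c * \<eta>) > 0" using \<open>c > 0\<close> \<open>\<eta> > 0\<close> by simp
    ultimately show False by linarith
  qed
  let ?P = "\<lambda>x R. \<P>(w in (weight_space :: ((int ^ 'd) set \<Rightarrow> real) measure).
    passage_time (K R) w 0 x < boundary_time (K R) w R)"
  have "\<forall>\<^sub>F R in sequentially. (\<Sum>k<N. ?P (x k) R) \<le> 4 * \<eta> * real N"
  proof -
    \<comment> \<open>Half of the gap is used twice: one factor bounds the number of edges, the
      other absorbs the factor 2.\<close>
    have "\<forall>\<^sub>F R in sequentially. real (card (ball_edges R :: (int ^ 'd) set set)) \<le> exp (K R * ((p' - p) / 2))"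
      unfolding K_def using e p by (intro K_param_gap) auto
    moreover have "\<forall>\<^sub>F R in sequentially. 0 \<le> K R"
      using K_param_at_top[OF e, where 'd = 'd] by (simp add: filterlim_at_top K_def)
    ultimately show ?thesis
      using eventually_ge_at_top[of 2]
    proof eventually_elim
      case (elim R)
      let ?n = "card (ball_edges R :: (int ^ 'd) set set)"
      have n2: "2 \<le> ?n" using card_ball_edges_ge[of R, where 'd = 'd] elim(3) by linarith
      have "2 * real ?n \<le> exp (K R * ((p' - p) / 2)) * exp (K R * ((p' - p) / 2))"
        using n2 elim(1) by (intro mult_mono) auto
      also have "\<dots> = exp (K R * (p' - p))" by (simp add: exp_add[symmetric] field_simps)
      finally have gap: "2 * real ?n \<le> exp (K R * (p' - p))" .
      have "(\<Sum>k<N. ?P (x k) R) \<le> (\<Sum>k<N. 3 * \<eta> + \<P>(w in weight_space. entered_first (K R) p s (x k) w) / c)"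
      proof (rule sum_mono)
        fix k
        show "?P (x k) R \<le> 3 * \<eta> + \<P>(w in weight_space. entered_first (K R) p s (x k) w) / c"
          using passage_prob_le[OF elim(2) p(3,4,2) mns(1,2) far[of k] gap] mns(3)[of "x k"]
          unfolding c_def by linarith
      qed
      also have "\<dots> = 3 * \<eta> * real N + (\<Sum>k<N. \<P>(w in weight_space. entered_first (K R) p s (x k) w)) / c"
        by (simp add: sum.distrib sum_divide_distrib)
      also have "\<dots> \<le> 3 * \<eta> * real N + 1 / c"
        using sum_prob_entered_first_le[OF elim(2) disj] \<open>c > 0\<close>
        by (intro add_left_mono divide_right_mono) auto
      also have "1 / c \<le> \<eta> * real N"
        using N \<open>c > 0\<close> \<open>\<eta> > 0\<close> by (simp add: field_simps)
      finally show ?case by simp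
    qed
  qed
  moreover have "\<exists>k<N. liminf (\<lambda>R. ereal (?P (x k) R)) \<le> ereal a"
  proof (rule ccontr)
    assume "\<not> ?thesis"
    then have "ereal a < liminf (\<lambda>R. ereal (?P (x k) R))" if "k \<in> {..<N}" for k
      using that by (auto simp: not_le)
    then have "\<forall>k\<in>{..<N}. \<forall>\<^sub>F R in sequentially. ereal a < ereal (?P (x k) R)"
      by (intro ballI less_LiminfD)
    then have "\<forall>\<^sub>F R in sequentially. \<forall>k\<in>{..<N}. ereal a < ereal (?P (x k) R)"
      by (rule eventually_ball_finite[OF finite_lessThan])
    with calculation have "\<forall>\<^sub>F R :: nat in sequentially. False"
    proof eventually_elim
      case (elim R)
      have "a * real N = (\<Sum>k<N. a)" by simp
      also have "\<dots> \<le> (\<Sum>k<N. ?P (x k) R)"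
        using elim(2) by (intro sum_mono) (simp add: less_imp_le)
      also have "\<dots> \<le> 4 * \<eta> * real N" by (rule elim(1))
      finally show False using \<open>N > 0\<close> \<open>0 < a\<close> by (simp add: \<eta>_def)
    qed
    then show False by simp
  qed
  ultimately show ?thesis by blast
qed

theorem corollary3p2:
  fixes \<epsilon> :: real
  assumes "0 < \<epsilon>" and "\<epsilon> \<le> 2"
  shows "(INF x :: int ^ 'd::finite.
            liminf (\<lambda>R. ereal (measure weight_space
              {w \<in> space weight_space.
                 passage_time (K_param TYPE('d) R (\<epsilon> / 2)) w 0 x
                   < boundary_time (K_param TYPE('d) R (\<epsilon> / 2)) w R}))) = 0
         \<longleftrightarrow> percolation_prob TYPE('d) (critical_prob TYPE('d)) = 0"
proof -
  let ?pc = "critical_prob TYPE('d)"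
  define K where "K R = K_param TYPE('d) R (\<epsilon> / 2)" for R
  define L where "L x = liminf (\<lambda>R. ereal (\<P>(w in weight_space.
    passage_time (K R) w 0 x < boundary_time (K R) w R)))" for x :: "int ^ 'd"
  have e: "0 < \<epsilon> / 2" "\<epsilon> / 2 \<le> 1" using assms by auto
  have "(INF x. L x) = 0 \<longleftrightarrow> percolation_prob TYPE('d) ?pc = 0"
  proof
    assume crit: "percolation_prob TYPE('d) ?pc = 0"
    show "(INF x. L x) = 0"
    proof (rule antisym)
      show "0 \<le> (INF x. L x)"
        unfolding L_def by (intro INF_greatest Liminf_bounded) simp
      show "(INF x. L x) \<le> 0"
      proof (rule ccontr)
        assume "\<not> (INF x. L x) \<le> 0"
        then obtain a where a: "0 < ereal a" "ereal a < (INF x. L x)"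
          using ereal_dense2[of 0 "INF x. L x"] by (auto simp: not_le)
        then obtain x where "L x \<le> ereal a"
          using ex_liminf_le[OF e _ crit] unfolding L_def K_def by fastforce
        moreover have "(INF x. L x) \<le> L x" by (rule INF_lower) simp
        ultimately show False using a(2) by (meson leD le_less_trans less_le_trans)
      qed
    qed
  next
    assume INF: "(INF x. L x) = 0"
    show "percolation_prob TYPE('d) ?pc = 0"
    proof (rule ccontr)
      assume "percolation_prob TYPE('d) ?pc \<noteq> 0"
      then have pos: "percolation_prob TYPE('d) ?pc > 0"
        by (simp add: percolation_prob_def zero_less_measure_iff)
      \<comment> \<open>There is no percolation at levels up to 0, so a percolating critical level
        is positive, as \<open>connection_lower_bound\<close> demands.\<close>
      then have pc: "0 < ?pc"
        using percolation_prob_nonpos[of ?pc, where 'd = 'd] by force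
      obtain c where c: "c > 0" "\<And>x :: int ^ 'd. c \<le> \<P>(w in weight_space. x \<in> component {e. w e < ?pc} 0)"
        using connection_lower_bound[OF pc critical_prob_bounds(2) pos] by blast
      have K: "filterlim K at_top sequentially"
        unfolding K_def by (rule K_param_at_top[OF e])
      have "ereal (c / 2) \<le> L x" for x
        unfolding L_def
        using eventually_prob_ge_connection[OF K pc c(1) c(2)[of x]]
        by (intro Liminf_bounded) simp
      then have "ereal (c / 2) \<le> (INF x. L x)" by (rule INF_greatest)
      with INF c(1) show False by (simp add: zero_ereal_def)
    qed
  qed
  then show ?thesis by (simp only: L_def K_def)
qed

end
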